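(* Let $Z$ be the Riemann species, i.e. the species such that $Z(S)$ is the set of ways of making the finite set $S$ into a semisimple commutative ring (equivalently, $Z={\prod_{p\in\mathbb{P}}}^D\exp_D(F_p)$). Then its Dirichlet series is the Riemann zeta function: $\widehat{Z}(s)=\sum_{n\ge1}n^{-s}$ as formal Dirichlet series; equivalently, for every $n\ge1$ there are exactly $n!$ ways to make an $n$-element set into a semisimple commutative ring.
   Context: A species is a functor from the groupoid of finite sets and bijections to $\mathbf{Set}$. A "way of making $S$ into a semisimple commutative ring" is a choice of addition and multiplication on $S$ making it a semisimple commutative ring (for finite rings: a finite product of finite fields, the one-element ring being the empty product). For a species $F$ with finite values, $\widehat{F}(s)=\sum_{n\ge1}\frac{|F(n)|}{n!}n^{-s}$, with $F(n)$ the value on an $n$-element set. In the paper, $F_p$ is the species of field structures of characteristic $p$, $\exp_D$ the Dirichlet exponential and ${\prod}^D$ the Euler product of species (built from the Dirichlet product, in which a structure on $S$ is a decomposition of $S$ as a cartesian product of two sets with a structure on each factor); the resulting species is the species of semisimple commutative ring structures. *)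

theory Defs
  imports "HOL-Algebra.Algebra" "HOL-Library.FuncSet"
begin

definition ring_on :: "'a set \<Rightarrow> ('a \<Rightarrow> 'a \<Rightarrow> 'a) \<Rightarrow> ('a \<Rightarrow> 'a \<Rightarrow> 'a) \<Rightarrow> 'a \<Rightarrow> 'a \<Rightarrow> 'a ring"
  where "ring_on S a m z u = \<lparr>carrier = S, monoid.mult = m, one = u, ring.zero = z, ring.add = a\<rparr>"

text \<open>A (finite) semisimple commutative ring: a commutative ring isomorphic to a finite
  product of finite fields (the empty product being the one-element ring).\<close>
definition semisimple_finite_cring :: "('a, 'b) ring_scheme \<Rightarrow> bool"
  where "semisimple_finite_cring R \<longleftrightarrow> cring R \<and>
     (\<exists>Fs :: nat ring list. (\<forall>F \<in> set Fs. field F \<and> finite (carrier F)) \<and>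
        R \<simeq> RDirProd_list Fs)"

text \<open>The species Z: ways of making S into a semisimple commutative ring, i.e. choices of
  addition and multiplication on S (binary operations S x S -> S, extensional outside S)
  such that, for suitable (uniquely determined) zero and one, S becomes a semisimple
  commutative ring.\<close>
definition riemann_species :: "'a set \<Rightarrow> (('a \<Rightarrow> 'a \<Rightarrow> 'a) \<times> ('a \<Rightarrow> 'a \<Rightarrow> 'a)) set"
  where "riemann_species S =
     {(a, m). a \<in> S \<rightarrow>\<^sub>E S \<rightarrow>\<^sub>E S \<and> m \<in> S \<rightarrow>\<^sub>E S \<rightarrow>\<^sub>E S \<and>
        (\<exists>z \<in> S. \<exists>u \<in> S. semisimple_finite_cring (ring_on S a m z u))}"

end

theory Submission
  imports Defs "HOL-Number_Theory.Prime_Powers" "HOL-Computational_Algebra.Polynomial"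
    "HOL-Combinatorics.Permutations"
begin

text \<open>A finite commutative ring is a product of fields iff it is reduced; its field factors correspond
  to the idempotents \<open>e\<close> for which the corner \<open>eR\<close> is a field, and \<open>\<bar>R\<bar> = \<Prod>\<^sub>e \<bar>eR\<bar>\<close>. Splitting off
  one field factor of order \<open>q = p\<^sup>k\<close> and using the strong induction hypothesis \<open>m!\<close> for the
  complementary factor of order \<open>m = n / q\<close>, the number of pairs \<open>(R, e)\<close> with \<open>\<bar>eR\<bar> = q\<close> is \<open>n! / k\<close>,
  because the field of order \<open>q\<close> exists, is unique, and has exactly \<open>k\<close> automorphisms. Hence, if \<open>N\<close>
  is the number of structures on an \<open>n\<close>-element set,
  \<open>N ln n = \<Sum>\<^sub>R \<Sum>\<^sub>e ln \<bar>eR\<bar> = n! \<Sum>\<^sub>q\<^sub>|\<^sub>n (ln q) / k = n! \<Sum>\<^sub>q\<^sub>|\<^sub>n \<Lambda>(q) = n! ln n\<close>: this is the logarithmic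
  derivative of the Euler product of the zeta function.\<close>

hide_const (open) Divisibility.prime Ring_Divisibility.mult_of Polynomial.order

section \<open>Finite reduced rings and their field idempotents\<close>

text \<open>The number of field factors varies from ring to ring, so counting pairs
  \<open>(R, e)\<close> does not by itself count rings. Weighting a pair by the logarithm of the
  order of its factor repairs this: the orders multiply to n for every R, so all rings have the same
  total weight. Reducedness is the working form of semisimplicity because it refers to no chosen
  factors: corners inherit it, and they live in the type of the ring itself. Testing squares
  suffices, as repeated squaring reaches every exponent 2^k. Fields on unrelated types are compared
  through integer polynomials: the elements of a finite field are values P(g) at a multiplicative
  generator g, and the relations among them form an ideal in the single type
  \<open>int poly\<close>. The k isomorphisms between two fields of order p^k are pinned from both
  sides: a polynomial of degree at most k annihilating g bounds their number above, and the powers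
  of the Frobenius map supply that many.\<close>

definition reduced_finite :: "('a, 'b) ring_scheme \<Rightarrow> bool" where
  "reduced_finite R \<longleftrightarrow> cring R \<and> finite (carrier R) \<and>
     (\<forall>x \<in> carrier R. x \<otimes>\<^bsub>R\<^esub> x = \<zero>\<^bsub>R\<^esub> \<longrightarrow> x = \<zero>\<^bsub>R\<^esub>)"

lemma reduced_finiteD:
  assumes "reduced_finite R"
  shows "cring R" "finite (carrier R)"
    "\<And>x. x \<in> carrier R \<Longrightarrow> x \<otimes>\<^bsub>R\<^esub> x = \<zero>\<^bsub>R\<^esub> \<Longrightarrow> x = \<zero>\<^bsub>R\<^esub>"
  using assms unfolding reduced_finite_def by blast+

lemma reduced_finiteI:
  assumes "cring R" "finite (carrier R)"
    "\<And>x. x \<in> carrier R \<Longrightarrow> x \<otimes>\<^bsub>R\<^esub> x = \<zero>\<^bsub>R\<^esub> \<Longrightarrow> x = \<zero>\<^bsub>R\<^esub>"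
  shows "reduced_finite R"
  using assms unfolding reduced_finite_def by blast

text \<open>The Peirce corner eR, written as the fixed points of multiplication by e. Only the
  carrier and the identity change, so nested corners can be literally equal records instead of
  merely isomorphic rings.\<close>

definition corner :: "('a, 'b) ring_scheme \<Rightarrow> 'a \<Rightarrow> ('a, 'b) ring_scheme" where
  "corner R e = R\<lparr>carrier := {x \<in> carrier R. e \<otimes>\<^bsub>R\<^esub> x = x}, one := e\<rparr>"

text \<open>In a finite reduced ring these are the primitive idempotents, one per field factor. A
  field has distinct zero and one, so the zero idempotent is excluded.\<close>

definition field_idempotents :: "('a, 'b) ring_scheme \<Rightarrow> 'a set" where
  "field_idempotents R = {e \<in> carrier R. e \<otimes>\<^bsub>R\<^esub> e = e \<and> field (corner R e)}"

lemma corner_simps [simp]: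
  "carrier (corner R e) = {x \<in> carrier R. e \<otimes>\<^bsub>R\<^esub> x = x}" "\<one>\<^bsub>corner R e\<^esub> = e"
  "\<zero>\<^bsub>corner R e\<^esub> = \<zero>\<^bsub>R\<^esub>" "x \<otimes>\<^bsub>corner R e\<^esub> y = x \<otimes>\<^bsub>R\<^esub> y" "x \<oplus>\<^bsub>corner R e\<^esub> y = x \<oplus>\<^bsub>R\<^esub> y"
  by (simp_all add: corner_def)

lemma RDirProd_simps [simp]:
  "carrier (RDirProd R S) = carrier R \<times> carrier S"
  "\<one>\<^bsub>RDirProd R S\<^esub> = (\<one>\<^bsub>R\<^esub>, \<one>\<^bsub>S\<^esub>)" "\<zero>\<^bsub>RDirProd R S\<^esub> = (\<zero>\<^bsub>R\<^esub>, \<zero>\<^bsub>S\<^esub>)"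
  "x \<otimes>\<^bsub>RDirProd R S\<^esub> y = (fst x \<otimes>\<^bsub>R\<^esub> fst y, snd x \<otimes>\<^bsub>S\<^esub> snd y)"
  "x \<oplus>\<^bsub>RDirProd R S\<^esub> y = (fst x \<oplus>\<^bsub>R\<^esub> fst y, snd x \<oplus>\<^bsub>S\<^esub> snd y)"
  by (simp_all add: RDirProd_def DirProd_def monoid.defs case_prod_beta)

section \<open>Corners of idempotents and the Peirce decomposition\<close>

context cring
begin

lemma corner_cring:
  assumes e: "e \<in> carrier R" "e \<otimes> e = e"
  shows "cring (corner R e)"
proof (rule cringI)
  have neg: "e \<otimes> (\<ominus> x) = \<ominus> x" if "x \<in> carrier R" "e \<otimes> x = x" for x
    using that e by (simp add: r_minus)
  show "abelian_group (corner R e)"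
  proof (rule abelian_groupI)
    fix x assume "x \<in> carrier (corner R e)"
    then show "\<exists>y\<in>carrier (corner R e). y \<oplus>\<^bsub>corner R e\<^esub> x = \<zero>\<^bsub>corner R e\<^esub>"
      using neg by (intro bexI[of _ "\<ominus> x"]) (auto simp: l_neg)
  next
    fix x y assume "x \<in> carrier (corner R e)" "y \<in> carrier (corner R e)"
    then show "x \<oplus>\<^bsub>corner R e\<^esub> y \<in> carrier (corner R e)"
      using e by (simp add: r_distr)
  next
    fix x y assume "x \<in> carrier (corner R e)" "y \<in> carrier (corner R e)"
    then show "x \<oplus>\<^bsub>corner R e\<^esub> y = y \<oplus>\<^bsub>corner R e\<^esub> x"
      by (simp add: a_comm)
  next
    fix x y z
    assume "x \<in> carrier (corner R e)" "y \<in> carrier (corner R e)" "z \<in> carrier (corner R e)"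
    then show "x \<oplus>\<^bsub>corner R e\<^esub> y \<oplus>\<^bsub>corner R e\<^esub> z
        = x \<oplus>\<^bsub>corner R e\<^esub> (y \<oplus>\<^bsub>corner R e\<^esub> z)"
      by (simp add: a_assoc)
  qed (use e in simp_all)
  show "comm_monoid (corner R e)"
  proof (rule comm_monoidI)
    fix x y assume "x \<in> carrier (corner R e)" "y \<in> carrier (corner R e)"
    then show "x \<otimes>\<^bsub>corner R e\<^esub> y \<in> carrier (corner R e)"
      using e by (simp flip: m_assoc)
  next
    fix x y assume "x \<in> carrier (corner R e)" "y \<in> carrier (corner R e)"
    then show "x \<otimes>\<^bsub>corner R e\<^esub> y = y \<otimes>\<^bsub>corner R e\<^esub> x"
      by (simp add: m_comm)
  qed (use e in \<open>simp_all add: m_assoc\<close>)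
  fix x y z
  assume "x \<in> carrier (corner R e)" "y \<in> carrier (corner R e)" "z \<in> carrier (corner R e)"
  then show "(x \<oplus>\<^bsub>corner R e\<^esub> y) \<otimes>\<^bsub>corner R e\<^esub> z
      = x \<otimes>\<^bsub>corner R e\<^esub> z \<oplus>\<^bsub>corner R e\<^esub> y \<otimes>\<^bsub>corner R e\<^esub> z"
    by (simp add: l_distr)
qed

lemma complement_idem:
  assumes e: "e \<in> carrier R" "e \<otimes> e = e"
  shows "(\<one> \<ominus> e) \<otimes> (\<one> \<ominus> e) = \<one> \<ominus> e" "e \<otimes> (\<one> \<ominus> e) = \<zero>"
    "e \<oplus> (\<one> \<ominus> e) = \<one>"
proof -
  show *: "e \<otimes> (\<one> \<ominus> e) = \<zero>"
    using e by (simp add: r_distr minus_eq r_minus r_neg)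
  have "(\<one> \<ominus> e) \<otimes> (\<one> \<ominus> e) = (\<one> \<ominus> e) \<ominus> e \<otimes> (\<one> \<ominus> e)"
    using e by algebra
  then show "(\<one> \<ominus> e) \<otimes> (\<one> \<ominus> e) = \<one> \<ominus> e"
    using e * by (simp add: minus_eq)
  show "e \<oplus> (\<one> \<ominus> e) = \<one>"
    using e by algebra
qed

text \<open>The idempotents e and 1 - e annihilate each other and sum to one, so x is the sum of its
  two components and addition is the inverse map.\<close>

lemma corner_decomposition:
  assumes e: "e \<in> carrier R" "e \<otimes> e = e"
  shows "(\<lambda>x. (e \<otimes> x, (\<one> \<ominus> e) \<otimes> x))
    \<in> ring_iso R (RDirProd (corner R e) (corner R (\<one> \<ominus> e)))"
proof -
  note c = complement_idem[OF e]
  define f where "f = \<one> \<ominus> e"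
  have f: "f \<in> carrier R" "f \<otimes> f = f" "e \<otimes> f = \<zero>" "f \<otimes> e = \<zero>" "e \<oplus> f = \<one>"
    using c e by (auto simp: f_def m_comm)
  have ann: "e \<otimes> y = \<zero>" if "y \<in> carrier R" "f \<otimes> y = y" for y
    using e f that by (metis m_assoc l_null)
  have ann': "f \<otimes> y = \<zero>" if "y \<in> carrier R" "e \<otimes> y = y" for y
    using e f that by (metis m_assoc l_null)
  have split: "e \<otimes> x \<oplus> f \<otimes> x = x" if "x \<in> carrier R" for x
    using e f that by (metis l_distr l_one)
  have idem: "g \<otimes> (g \<otimes> x) = g \<otimes> x" if "g \<in> carrier R" "g \<otimes> g = g" "x \<in> carrier R" for g x
    using that by (metis m_assoc)
  have mult: "g \<otimes> (x \<otimes> y) = (g \<otimes> x) \<otimes> (g \<otimes> y)"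
    if "g \<in> carrier R" "g \<otimes> g = g" "x \<in> carrier R" "y \<in> carrier R" for g x y
    using that by (smt (verit) m_assoc m_comm m_closed)
  show ?thesis
    unfolding f_def[symmetric]
  proof (rule ring_iso_memI)
    show "bij_betw (\<lambda>x. (e \<otimes> x, f \<otimes> x)) (carrier R)
        (carrier (RDirProd (corner R e) (corner R f)))"
    proof (rule bij_betw_byWitness[where f' = "\<lambda>p. fst p \<oplus> snd p"])
      show "\<forall>a\<in>carrier R. fst (e \<otimes> a, f \<otimes> a) \<oplus> snd (e \<otimes> a, f \<otimes> a) = a"
        using split by simp
      show "\<forall>p\<in>carrier (RDirProd (corner R e) (corner R f)).
          (e \<otimes> (fst p \<oplus> snd p), f \<otimes> (fst p \<oplus> snd p)) = p"
      proof
        fix p assume "p \<in> carrier (RDirProd (corner R e) (corner R f))"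
        then have p: "fst p \<in> carrier R" "snd p \<in> carrier R" "e \<otimes> fst p = fst p" "f \<otimes> snd p = snd p"
          by auto
        then show "(e \<otimes> (fst p \<oplus> snd p), f \<otimes> (fst p \<oplus> snd p)) = p"
          using e f ann[OF p(2,4)] ann'[OF p(1,3)] by (cases p) (simp add: r_distr)
      qed
      show "(\<lambda>x. (e \<otimes> x, f \<otimes> x)) ` carrier R \<subseteq> carrier (RDirProd (corner R e) (corner R f))"
        using e f idem by auto
      show "(\<lambda>p. fst p \<oplus> snd p) ` carrier (RDirProd (corner R e) (corner R f)) \<subseteq> carrier R"
        by auto
    qed
  next
    fix x y assume "x \<in> carrier R" "y \<in> carrier R"
    then show "(e \<otimes> (x \<otimes> y), f \<otimes> (x \<otimes> y))
        = (e \<otimes> x, f \<otimes> x) \<otimes>\<^bsub>RDirProd (corner R e) (corner R f)\<^esub> (e \<otimes> y, f \<otimes> y)"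
      using mult[OF e] mult[OF f(1,2)] by simp
  next
    fix x assume "x \<in> carrier R"
    then show "(e \<otimes> x, f \<otimes> x) \<in> carrier (RDirProd (corner R e) (corner R f))"
      using idem[OF e] idem[OF f(1,2)] e f by simp
  qed (use e f in \<open>simp_all add: r_distr\<close>)
qed

text \<open>Fixed points of f are already fixed by e, so cutting down twice is cutting down once.
  Field idempotents of a corner can thus be read as field idempotents of the whole ring.\<close>

lemma corner_corner:
  assumes "e \<in> carrier R" "f \<in> carrier R" "e \<otimes> f = f"
  shows "corner (corner R e) f = corner R f"
proof -
  have "e \<otimes> x = x" if "x \<in> carrier R" "f \<otimes> x = x" for x
    using assms that by (metis m_assoc)
  then have "{x \<in> carrier R. e \<otimes> x = x \<and> f \<otimes> x = x} = {x \<in> carrier R. f \<otimes> x = x}"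
    by auto
  then show ?thesis
    by (simp add: corner_def)
qed

text \<open>The product ef is an idempotent of both corners. The only nonzero idempotent of a field
  is its identity, so a nonzero ef would equal both e and f.\<close>

lemma field_idempotents_orthogonal:
  assumes "e \<in> field_idempotents R" "f \<in> field_idempotents R" "e \<noteq> f"
  shows "e \<otimes> f = \<zero>"
proof (rule ccontr)
  assume ne: "e \<otimes> f \<noteq> \<zero>"
  have e: "e \<in> carrier R" "e \<otimes> e = e" "field (corner R e)"
    and f: "f \<in> carrier R" "f \<otimes> f = f" "field (corner R f)"
    using assms by (auto simp: field_idempotents_def)
  have id: "(e \<otimes> f) \<otimes> (e \<otimes> f) = e \<otimes> f"
    using e f by (smt (verit) m_assoc m_comm m_closed)
  have one: "x = g" if "field (corner R g)" "x \<in> carrier R" "g \<in> carrier R" "g \<otimes> x = x" "x \<otimes> x = x" "x \<noteq> \<zero>" for x g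
  proof -
    interpret G: field "corner R g" by fact
    have "x \<otimes>\<^bsub>corner R g\<^esub> x = x \<otimes>\<^bsub>corner R g\<^esub> \<one>\<^bsub>corner R g\<^esub>"
      using that by (simp add: m_comm)
    then show ?thesis
      using G.m_lcancel[of x x "\<one>\<^bsub>corner R g\<^esub>"] that G.one_closed by auto
  qed
  have ef: "e \<otimes> f \<in> carrier R" "e \<otimes> (e \<otimes> f) = e \<otimes> f" "f \<otimes> (e \<otimes> f) = e \<otimes> f"
    using e f by (simp, metis m_assoc, metis m_assoc m_comm)
  have "e \<otimes> f = e"
    by (rule one) (fact e(3) ef e(1) id ne)+
  moreover have "e \<otimes> f = f"
    by (rule one) (fact f(3) ef f(1) id ne)+
  ultimately show False using assms by simp
qed

text \<open>Orthogonality makes every field idempotent other than e a fixed point of 1 - e, hence an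
  element of the complementary corner, where by \<open>corner_corner\<close> it cuts out the same
  field.\<close>

lemma field_idempotents_split:
  assumes e: "e \<in> field_idempotents R"
  shows "field_idempotents R = insert e (field_idempotents (corner R (\<one> \<ominus> e)))"
    and "e \<notin> field_idempotents (corner R (\<one> \<ominus> e))"
proof -
  have e': "e \<in> carrier R" "e \<otimes> e = e" "field (corner R e)"
    using e by (auto simp: field_idempotents_def)
  have nz: "e \<noteq> \<zero>"
    using domain.one_not_zero[OF field.axioms(1)[OF e'(3)]] by simp
  note c = complement_idem[OF e'(1,2)]
  have cc: "(\<one> \<ominus> e) \<otimes> f = f" if "f \<in> carrier R" "e \<otimes> f = \<zero>" for f
    using that e' by (simp add: minus_eq l_distr l_minus)
  show "e \<notin> field_idempotents (corner R (\<one> \<ominus> e))"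
  proof -
    have "(\<one> \<ominus> e) \<otimes> e \<noteq> e" using e' nz c(2) by (simp add: m_comm)
    then show ?thesis by (simp add: field_idempotents_def)
  qed
  show "field_idempotents R = insert e (field_idempotents (corner R (\<one> \<ominus> e)))"
  proof (intro equalityI subsetI)
    fix f assume f: "f \<in> field_idempotents R"
    show "f \<in> insert e (field_idempotents (corner R (\<one> \<ominus> e)))"
    proof (cases "f = e")
      case False
      then have "e \<otimes> f = \<zero>"
        using field_idempotents_orthogonal[OF e f] by simp
      moreover have f': "f \<in> carrier R" "f \<otimes> f = f" "field (corner R f)"
        using f by (auto simp: field_idempotents_def)
      ultimately have "(\<one> \<ominus> e) \<otimes> f = f" using cc by blast
      moreover from this have "field (corner (corner R (\<one> \<ominus> e)) f)"
        using f' e' corner_corner by simp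
      ultimately show ?thesis
        using f' by (simp add: field_idempotents_def)
    qed simp
  next
    fix f assume "f \<in> insert e (field_idempotents (corner R (\<one> \<ominus> e)))"
    then show "f \<in> field_idempotents R"
    proof
      assume "f \<in> field_idempotents (corner R (\<one> \<ominus> e))"
      then have f: "f \<in> carrier R" "(\<one> \<ominus> e) \<otimes> f = f" "f \<otimes> f = f"
        and F: "field (corner (corner R (\<one> \<ominus> e)) f)"
        by (simp_all add: field_idempotents_def)
      have "field (corner R f)"
        using F corner_corner[OF _ f(1,2)] e' by simp
      with f show ?thesis by (simp add: field_idempotents_def)
    qed (use e in simp)
  qed
qed

end

lemma reduced_finite_corner:
  assumes "reduced_finite R" "e \<in> carrier R" "e \<otimes>\<^bsub>R\<^esub> e = e"
  shows "reduced_finite (corner R e)"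
proof (rule reduced_finiteI)
  show "cring (corner R e)"
    using cring.corner_cring[OF reduced_finiteD(1)[OF assms(1)] assms(2,3)] .
  show "finite (carrier (corner R e))"
    using reduced_finiteD(2)[OF assms(1)] by simp
  fix x assume "x \<in> carrier (corner R e)" "x \<otimes>\<^bsub>corner R e\<^esub> x = \<zero>\<^bsub>corner R e\<^esub>"
  then show "x = \<zero>\<^bsub>corner R e\<^esub>"
    using reduced_finiteD(3)[OF assms(1), of x] by simp
qed

text \<open>A nonzero idempotent of minimal corner: any nonzero element of the corner is not nilpotent,
  so one of its powers is a nonzero idempotent, which minimality forces to be the identity.\<close>
lemma reduced_finite_field_idempotent:
  fixes R (structure)
  assumes R: "reduced_finite R" and ne: "\<one> \<noteq> \<zero>"
  shows "\<exists>e. e \<in> field_idempotents R"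
proof -
  interpret cring R using R by (simp add: reduced_finite_def)
  have fin: "finite (carrier R)" using R by (simp add: reduced_finite_def)
  have red: "x = \<zero>" if "x \<in> carrier R" "x \<otimes> x = \<zero>" for x
    using reduced_finiteD(3)[OF R that] .
  have nilp: "x = \<zero>" if "x \<in> carrier R" "x [^] (2 ^ k :: nat) = \<zero>" for x k
    using that
  proof (induction k)
    case (Suc k)
    then show ?case
      using red[of "x [^] (2 ^ k :: nat)"] by (simp add: nat_pow_mult mult_2)
  qed simp
  have nz: "x [^] (k :: nat) \<noteq> \<zero>" if "x \<in> carrier R" "x \<noteq> \<zero>" for x k
  proof
    assume "x [^] k = \<zero>"
    \<comment> \<open>The exponent is padded from k to the larger 2^k, the form that
      \<open>nilp\<close> handles.\<close>
    then have "x [^] (k + (2 ^ k - k)) = \<zero>"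
      using that by (subst nat_pow_mult[symmetric]) auto
    moreover have "k + (2 ^ k - k) = (2 ^ k :: nat)"
      using less_exp[of k] by simp
    ultimately show False using nilp that by metis
  qed
  have idem: "\<exists>n. n > 0 \<and> x [^] (n + n) = x [^] (n :: nat)" if x: "x \<in> carrier R" for x
  proof -
    have "\<not> inj (\<lambda>n :: nat. x [^] n)"
      using fin x by (metis finite_subset image_subsetI infinite_UNIV_nat nat_pow_closed
          range_inj_infinite)
    then obtain a b :: nat where "x [^] a = x [^] b" "a \<noteq> b"
      by (auto simp: inj_def)
    then obtain a b :: nat where ab: "x [^] a = x [^] b" "a < b"
      by (metis linorder_neqE_nat)
    define d where "d = b - a"
    have d: "d > 0" "x [^] (a + d) = x [^] a"
      using ab by (simp_all add: d_def)
    have per: "x [^] (m + k * d) = x [^] m" if "m \<ge> a" for m k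
    proof (induction k)
      case (Suc k)
      have "x [^] (m + Suc k * d) = x [^] ((a + d) + ((m - a) + k * d))"
        using that by (simp add: algebra_simps)
      also have "\<dots> = x [^] (a + ((m - a) + k * d))"
        using x d by (metis nat_pow_mult)
      finally show ?case using Suc that by simp
    qed simp
    \<comment> \<open>The exponent (a+1)d is a multiple of the period d and at least the preperiod
      a. Doubling it therefore leaves the power unchanged, so this power is idempotent.\<close>
    have "a * d + d \<ge> a" using d by (cases d) auto
    then have "x [^] ((a * d + d) + Suc a * d) = x [^] (a * d + d)"
      by (rule per)
    then show ?thesis
      using d by (intro exI[of _ "a * d + d"]) (simp add: algebra_simps)
  qed
  define I where "I = {e \<in> carrier R. e \<otimes> e = e \<and> e \<noteq> \<zero>}"
  have "finite I" "\<one> \<in> I" using fin ne by (auto simp: I_def)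
  then obtain e where e: "e \<in> I"
    and min: "\<And>f. f \<in> I \<Longrightarrow> card (carrier (corner R e)) \<le> card (carrier (corner R f))"
    using ex_min_if_finite[of "(\<lambda>e. card (carrier (corner R e))) ` I"]
    by (metis arg_min_if_finite(1) arg_min_least empty_iff)
  have e': "e \<in> carrier R" "e \<otimes> e = e" "e \<noteq> \<zero>" using e by (auto simp: I_def)
  have "field (corner R e)"
  proof (rule cring.cring_fieldI2)
    show "cring (corner R e)" using corner_cring e' by blast
    show "\<zero>\<^bsub>corner R e\<^esub> \<noteq> \<one>\<^bsub>corner R e\<^esub>" using e' by simp
    fix x assume "x \<in> carrier (corner R e)" "x \<noteq> \<zero>\<^bsub>corner R e\<^esub>"
    then have x: "x \<in> carrier R" "e \<otimes> x = x" "x \<noteq> \<zero>" by auto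
    obtain n where n: "n > 0" "x [^] (n + n) = x [^] (n :: nat)" using idem x by blast
    define f where "f = x [^] n"
    have ex: "e \<otimes> x [^] m = x [^] m" if "m > 0" for m :: nat
      using that
    proof (induction m)
      case (Suc m)
      then show ?case
        using x e' by (metis m_assoc m_comm nat_pow_Suc nat_pow_closed)
    qed simp
    have f: "f \<in> carrier R" "f \<otimes> f = f" "f \<noteq> \<zero>" "e \<otimes> f = f"
      using x n nz ex by (auto simp: f_def nat_pow_mult)
    have sub: "carrier (corner R f) \<subseteq> carrier (corner R e)"
      using f e' by auto (metis m_assoc)
    have "f \<in> I" using f by (auto simp: I_def)
    then have "carrier (corner R f) = carrier (corner R e)"
      using min[of f] sub fin by (intro card_seteq) auto
    then have "e \<in> carrier (corner R f)" using e' by auto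
    then have "f = e" using f e' by (simp add: m_comm)
    \<comment> \<open>The factor e matters when n = 1: then the power of x is the identity of R,
      which may lie outside the corner.\<close>
    define y where "y = e \<otimes> x [^] (n - 1)"
    have "x \<otimes> y = e \<otimes> x [^] (Suc (n - 1))"
      using x e' unfolding y_def nat_pow_Suc by (metis m_assoc m_comm nat_pow_closed)
    also have "\<dots> = e" using n \<open>f = e\<close> ex f_def e' by simp
    finally have "x \<otimes> y = e" .
    moreover have "y \<in> carrier R" "e \<otimes> y = y"
      using x e' by (auto simp: y_def m_assoc[symmetric])
    ultimately show "\<exists>b\<in>carrier (corner R e). x \<otimes>\<^bsub>corner R e\<^esub> b = \<one>\<^bsub>corner R e\<^esub>"
      by auto
  qed
  then show ?thesis using e' by (auto simp: field_idempotents_def)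
qed

lemma reduced_finite_card_split:
  fixes R (structure)
  assumes R: "reduced_finite R" and e: "e \<in> carrier R" "e \<otimes> e = e"
  shows "card (carrier R) = card (carrier (corner R e)) * card (carrier (corner R (\<one> \<ominus> e)))"
proof -
  interpret cring R using R by (simp add: reduced_finite_def)
  show ?thesis
    using bij_betw_same_card[OF ring_iso_memE(5)[OF corner_decomposition[OF e]]]
    by (simp add: card_cartesian_product)
qed

lemma field_card_ge_2: "field F \<Longrightarrow> finite (carrier F) \<Longrightarrow> 2 \<le> card (carrier F)"
proof -
  assume "field F" and fin: "finite (carrier F)"
  interpret field F by fact
  have "card {\<zero>\<^bsub>F\<^esub>, \<one>\<^bsub>F\<^esub>} \<le> card (carrier F)"
    using fin by (intro card_mono) auto
  then show ?thesis by simp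
qed

text \<open>Peels off one field factor at a time: the corner at a field idempotent has at least two
  elements, so the complementary corner is strictly smaller than R.\<close>

lemma reduced_finite_induct [consumes 1, case_names trivial split]:
  fixes R :: "('a, 'b) ring_scheme" (structure)
  assumes R: "reduced_finite R"
    and triv: "\<And>R :: ('a, 'b) ring_scheme. reduced_finite R \<Longrightarrow> \<one>\<^bsub>R\<^esub> = \<zero>\<^bsub>R\<^esub> \<Longrightarrow> P R"
    and split: "\<And>(R :: ('a, 'b) ring_scheme) e. reduced_finite R \<Longrightarrow> e \<in> field_idempotents R \<Longrightarrow>
      P (corner R (\<one>\<^bsub>R\<^esub> \<ominus>\<^bsub>R\<^esub> e)) \<Longrightarrow> P R"
  shows "P R"
  using R
proof (induction "card (carrier R)" arbitrary: R rule: less_induct)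
  case less
  show ?case
  proof (cases "\<one>\<^bsub>R\<^esub> = \<zero>\<^bsub>R\<^esub>")
    case False
    interpret cring R using less.prems by (simp add: reduced_finite_def)
    obtain e where e: "e \<in> field_idempotents R"
      using reduced_finite_field_idempotent less.prems False by blast
    then have e': "e \<in> carrier R" "e \<otimes>\<^bsub>R\<^esub> e = e" "field (corner R e)"
      by (auto simp: field_idempotents_def)
    let ?C = "corner R (\<one>\<^bsub>R\<^esub> \<ominus>\<^bsub>R\<^esub> e)"
    have C: "reduced_finite ?C"
      using reduced_finite_corner[OF less.prems] e' complement_idem(1)[OF e'(1,2)] by simp
    have "finite (carrier (corner R e))"
      using less.prems by (simp add: reduced_finite_def)
    then have "card (carrier (corner R e)) \<ge> 2"
      using e' field_card_ge_2 by blast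
    moreover have "card (carrier ?C) > 0"
    proof -
      have "\<zero>\<^bsub>R\<^esub> \<in> carrier ?C" using e' by simp
      moreover have "finite (carrier ?C)" using C by (simp add: reduced_finite_def)
      ultimately show ?thesis using card_gt_0_iff by blast
    qed
    ultimately have "card (carrier ?C) < card (carrier R)"
      unfolding reduced_finite_card_split[OF less.prems e'(1,2)] by simp
    then show ?thesis using less.hyps C split less.prems e by blast
  qed (use triv less.prems in blast)
qed

text \<open>After taking logarithms, this says that a ring of order n carries total weight ln n
  however many factors it has.\<close>

lemma prod_card_field_idempotents:
  assumes "reduced_finite R"
  shows "(\<Prod>e\<in>field_idempotents R. card (carrier (corner R e))) = card (carrier R)"
  using assms
proof (induction rule: reduced_finite_induct)
  case (trivial R)
  interpret cring R using trivial by (simp add: reduced_finite_def)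
  have c: "carrier R = {\<zero>\<^bsub>R\<^esub>}" using trivial one_zeroD by blast
  have "field_idempotents R = {}"
  proof -
    have "False" if "e \<in> field_idempotents R" for e
    proof -
      have "e = \<zero>\<^bsub>R\<^esub>" "field (corner R e)"
        using that c by (auto simp: field_idempotents_def)
      then show False using domain.one_not_zero[OF field.axioms(1)] by fastforce
    qed
    then show ?thesis by blast
  qed
  then show ?case using c by simp
next
  case (split R e)
  interpret cring R using split by (simp add: reduced_finite_def)
  have e': "e \<in> carrier R" "e \<otimes>\<^bsub>R\<^esub> e = e" "field (corner R e)"
    using split by (auto simp: field_idempotents_def)
  let ?f = "\<one>\<^bsub>R\<^esub> \<ominus>\<^bsub>R\<^esub> e"
  have cc: "corner (corner R ?f) g = corner R g" if "g \<in> field_idempotents (corner R ?f)" for g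
    using that e' by (auto simp: field_idempotents_def intro!: corner_corner)
  have fin: "finite (field_idempotents (corner R ?f))"
    using split by (auto simp: field_idempotents_def reduced_finite_def)
  have "(\<Prod>g\<in>field_idempotents R. card (carrier (corner R g)))
      = card (carrier (corner R e)) * (\<Prod>g\<in>field_idempotents (corner R ?f). card (carrier (corner R g)))"
    unfolding field_idempotents_split(1)[OF split(2)]
    using fin field_idempotents_split(2)[OF split(2)] by (rule prod.insert)
  also have "(\<Prod>g\<in>field_idempotents (corner R ?f). card (carrier (corner R g)))
      = (\<Prod>g\<in>field_idempotents (corner R ?f). card (carrier (corner (corner R ?f) g)))"
    by (intro prod.cong refl) (simp add: cc)
  also have "\<dots> = card (carrier (corner R ?f))" by (rule split)
  also have "card (carrier (corner R e)) * \<dots> = card (carrier R)"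
    using reduced_finite_card_split split(1) e' by metis
  finally show ?case .
qed

section \<open>Reduced finite rings are the finite products of finite fields\<close>

lemma ring_iso_memI_cring:
  fixes R (structure) and S (structure)
  assumes "cring R" "cring S" and bij: "bij_betw h (carrier R) (carrier S)"
    and m: "\<And>x y. x \<in> carrier R \<Longrightarrow> y \<in> carrier R \<Longrightarrow> h (x \<otimes> y) = h x \<otimes>\<^bsub>S\<^esub> h y"
    and a: "\<And>x y. x \<in> carrier R \<Longrightarrow> y \<in> carrier R \<Longrightarrow> h (x \<oplus> y) = h x \<oplus>\<^bsub>S\<^esub> h y"
  shows "h \<in> ring_iso R S"
proof (rule ring_iso_memI)
  interpret R: cring R by fact
  interpret S: cring S by fact
  show cl: "h x \<in> carrier S" if "x \<in> carrier R" for x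
    using bij that bij_betwE by blast
  \<comment> \<open>Surjectivity makes preservation of the identity automatic: if h(y) is the
    identity of S, then h(1) = h(1) h(y) = h(y). This suits structures that record only two
    operations.\<close>
  obtain y where y: "y \<in> carrier R" "h y = \<one>\<^bsub>S\<^esub>"
    using bij S.one_closed by (metis bij_betw_imp_surj_on imageE)
  show "h \<one> = \<one>\<^bsub>S\<^esub>"
    using m[OF y(1) R.one_closed] y cl[OF R.one_closed] by simp
qed (use assms in auto)

lemma ring_iso_zero:
  assumes "ring R" "ring S" "h \<in> ring_iso R S"
  shows "h \<zero>\<^bsub>R\<^esub> = \<zero>\<^bsub>S\<^esub>"
  using assms ring_hom_zero unfolding ring_iso_def by blast

lemma reduced_finite_iso:
  assumes "cring R" "reduced_finite S" "h \<in> ring_iso R S"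
  shows "reduced_finite R"
proof -
  interpret R: cring R by fact
  interpret S: cring S using assms by (simp add: reduced_finite_def)
  note h = ring_iso_memE[OF assms(3)]
  have z: "h \<zero>\<^bsub>R\<^esub> = \<zero>\<^bsub>S\<^esub>"
    using ring_iso_zero R.ring_axioms S.ring_axioms assms by blast
  show ?thesis
  proof (rule reduced_finiteI)
    fix x assume x: "x \<in> carrier R" "x \<otimes>\<^bsub>R\<^esub> x = \<zero>\<^bsub>R\<^esub>"
    have "h x \<otimes>\<^bsub>S\<^esub> h x = \<zero>\<^bsub>S\<^esub>" using h(2)[OF x(1) x(1)] x(2) z by simp
    then have "h x = h \<zero>\<^bsub>R\<^esub>" using reduced_finiteD(3)[OF assms(2) h(1)[OF x(1)]] z by simp
    then show "x = \<zero>\<^bsub>R\<^esub>"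
      using inj_onD[OF bij_betw_imp_inj_on[OF h(5)] _ x(1) R.zero_closed] by blast
  next
    show "cring R" by fact
    show "finite (carrier R)"
      using bij_betw_finite[OF h(5)] reduced_finiteD(2)[OF assms(2)] by blast
  qed
qed

lemma cring_iso:
  assumes "cring R" "ring S" "h \<in> ring_iso R S"
  shows "cring S"
  using cring.ring_iso_imp_img_cring[OF assms(1,3)]
    ring_iso_zero[OF cring.axioms(1)[OF assms(1)] assms(2,3)] by simp

lemma cring_RDirProd:
  assumes "cring R" "cring S"
  shows "cring (RDirProd R S)"
proof -
  interpret R: cring R by fact
  interpret S: cring S by fact
  interpret P: ring "RDirProd R S" using RDirProd_ring R.ring_axioms S.ring_axioms by blast
  show ?thesis
    by unfold_locales (auto simp: R.m_comm S.m_comm)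
qed

lemma reduced_finite_RDirProd:
  assumes "reduced_finite R" "reduced_finite S"
  shows "reduced_finite (RDirProd R S)"
proof (rule reduced_finiteI)
  show "cring (RDirProd R S)"
    using cring_RDirProd assms[THEN reduced_finiteD(1)] .
  show "finite (carrier (RDirProd R S))"
    using assms[THEN reduced_finiteD(2)] by simp
  fix x
  assume "x \<in> carrier (RDirProd R S)"
    "x \<otimes>\<^bsub>RDirProd R S\<^esub> x = \<zero>\<^bsub>RDirProd R S\<^esub>"
  then show "x = \<zero>\<^bsub>RDirProd R S\<^esub>"
    using reduced_finiteD(3)[OF assms(1), of "fst x"] reduced_finiteD(3)[OF assms(2), of "snd x"]
    by (cases x) simp
qed

lemma field_imp_reduced_finite:
  assumes "field F" "finite (carrier F)"
  shows "reduced_finite F"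
proof -
  interpret field F by fact
  show ?thesis
    using assms integral is_cring unfolding reduced_finite_def by blast
qed

lemma reduced_finite_nil_ring: "reduced_finite nil_ring"
proof -
  have "ring nil_ring" using RDirProd_list_is_ring[of "[]"] by simp
  then interpret ring nil_ring .
  have "cring nil_ring" by unfold_locales (auto simp: monoid.defs)
  then show ?thesis by (simp add: reduced_finite_def monoid.defs)
qed

lemma reduced_finite_RDirProd_list:
  assumes "\<forall>F \<in> set Fs. field F \<and> finite (carrier F)"
  shows "reduced_finite (RDirProd_list Fs)"
  using assms
proof (induction Fs)
  case Nil
  then show ?case using reduced_finite_nil_ring by simp
next
  case (Cons F Fs)
  have rings: "ring (RDirProd_list (F # Fs))" "ring (RDirProd F (RDirProd_list Fs))"
  proof -
    have "ring G" if "G \<in> set (F # Fs)" for G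
      using Cons.prems that by (meson field.is_ring)
    then show "ring (RDirProd_list (F # Fs))"
      by (intro RDirProd_list_is_ring) (use nth_mem in blast)
  next
    have "reduced_finite (RDirProd_list Fs)" using Cons by simp
    then show "ring (RDirProd F (RDirProd_list Fs))"
      using Cons.prems by (intro RDirProd_ring) (auto simp: reduced_finite_def cring.axioms field.is_ring)
  qed
  have red: "reduced_finite (RDirProd F (RDirProd_list Fs))"
    using Cons field_imp_reduced_finite by (intro reduced_finite_RDirProd) auto
  note iso = RDirProd_list_iso1[of F Fs]
  have "cring (RDirProd_list (F # Fs))"
    using cring_iso[OF _ rings(1) iso] red by (simp add: reduced_finite_def)
  then show ?case
    using reduced_finite_iso[OF _ red ring_iso_set_sym[OF rings(2) iso]] by blast
qed

lemma reduced_finite_imp_product_of_fields: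
  assumes "reduced_finite R"
  shows "\<exists>Fs :: nat ring list. (\<forall>F \<in> set Fs. field F \<and> finite (carrier F)) \<and> R \<simeq> RDirProd_list Fs"
  using assms
proof (induction rule: reduced_finite_induct)
  case (trivial R)
  interpret cring R using trivial by (simp add: reduced_finite_def)
  have c: "carrier R = {\<zero>\<^bsub>R\<^esub>}" using trivial one_zeroD by blast
  have "(\<lambda>_. []) \<in> ring_iso R nil_ring"
    by (rule ring_iso_memI) (auto simp: c bij_betw_def monoid.defs)
  then show ?case by (intro exI[of _ "[]"]) (auto simp: is_ring_iso_def)
next
  case (split R e)
  interpret cring R using split by (simp add: reduced_finite_def)
  have e': "e \<in> carrier R" "e \<otimes>\<^bsub>R\<^esub> e = e" "field (corner R e)"
    using split by (auto simp: field_idempotents_def)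
  let ?f = "\<one>\<^bsub>R\<^esub> \<ominus>\<^bsub>R\<^esub> e"
  obtain Fs :: "nat ring list" and h where Fs: "\<forall>F \<in> set Fs. field F \<and> finite (carrier F)"
    and h: "h \<in> ring_iso (corner R ?f) (RDirProd_list Fs)"
    using split(3) by (auto simp: is_ring_iso_def)
  have fin: "finite (carrier (corner R e))"
    using split by (auto simp: reduced_finite_def)
  \<comment> \<open>Semisimplicity is defined with factors of type \<open>nat ring\<close>, so the
    corner field is copied onto an initial segment of the naturals.\<close>
  then obtain g where g: "bij_betw g (carrier (corner R e)) {0..<card (carrier (corner R e))}"
    using ex_bij_betw_finite_nat by blast
  define F :: "nat ring" where "F = image_ring g (corner R e)"
  have inj: "inj_on g (carrier (corner R e))" using g by (simp add: bij_betw_def)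
  have gF: "g \<in> ring_iso (corner R e) F"
    unfolding F_def using inj by (rule inj_imp_image_ring_iso)
  have "field F"
    unfolding F_def using e'(3) inj by (rule field.inj_imp_image_ring_is_field)
  moreover have "finite (carrier F)"
    using ring_iso_memE(5)[OF gF] fin bij_betw_finite by blast
  moreover have "R \<simeq> RDirProd_list (F # Fs)"
    using ring_iso_set_trans[OF ring_iso_set_trans[OF corner_decomposition[OF e'(1,2)]
          RDirProd_iso6[OF gF h]] RDirProd_list_iso1]
    by (auto simp: is_ring_iso_def)
  ultimately show ?case using Fs by (intro exI[of _ "F # Fs"]) auto
qed

lemma semisimple_finite_cring_iff: "semisimple_finite_cring R \<longleftrightarrow> reduced_finite R"
proof
  assume "semisimple_finite_cring R"
  then show "reduced_finite R"
    using reduced_finite_iso reduced_finite_RDirProd_list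
    unfolding semisimple_finite_cring_def is_ring_iso_def by blast
next
  assume "reduced_finite R"
  then show "semisimple_finite_cring R"
    using reduced_finite_imp_product_of_fields
    by (auto simp: semisimple_finite_cring_def reduced_finite_def)
qed

section \<open>Finite fields\<close>

lemma frobenius_add_dvd:
  fixes a b :: "'a :: comm_ring_1"
  assumes p: "prime p"
  shows "of_nat p dvd (a + b) ^ p - (a ^ p + b ^ p)"
proof -
  have p0: "p > 0" using p by (simp add: prime_gt_0_nat)
  have "(a + b) ^ p = (\<Sum>k\<le>p. of_nat (p choose k) * a ^ k * b ^ (p - k))"
    by (rule binomial_ring)
  also have "{..p} = insert 0 (insert p {0<..<p})" using p0 by auto
  also have "(\<Sum>k\<in>\<dots>. of_nat (p choose k) * a ^ k * b ^ (p - k))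
      = b ^ p + (a ^ p + (\<Sum>k\<in>{0<..<p}. of_nat (p choose k) * a ^ k * b ^ (p - k)))"
    using p0 by (subst sum.insert; simp)
  finally have "(a + b) ^ p - (a ^ p + b ^ p)
      = (\<Sum>k\<in>{0<..<p}. of_nat (p choose k) * a ^ k * b ^ (p - k))"
    by simp
  moreover have "of_nat p dvd (of_nat (p choose k) :: 'a)" if "k \<in> {0<..<p}" for k
    using dvd_choose_prime[of k p] p p0 that by (auto elim!: dvdE)
  ultimately show ?thesis by (auto intro!: dvd_sum dvd_mult2)
qed

text \<open>Divisibility by p in an arbitrary commutative ring covers \<open>int poly\<close>; from
  there evaluation carries the congruence into fields of characteristic p, and reduction carries it
  into the quotient that yields finite fields. In the step, the p-th power of a sum with error term
  p z is expanded twice, and (p z)^p is again divisible by p.\<close>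

lemma frobenius_power_add_dvd:
  fixes a b :: "'a :: comm_ring_1"
  assumes p: "prime p"
  shows "of_nat p dvd (a + b) ^ (p ^ k) - (a ^ (p ^ k) + b ^ (p ^ k))"
proof (induction k)
  case (Suc k)
  let ?q = "p ^ k" and ?P = "of_nat p :: 'a"
  obtain z where z: "(a + b) ^ ?q = (a ^ ?q + b ^ ?q) + ?P * z"
    using Suc by (auto elim!: dvdE simp: algebra_simps)
  have pp: "?P dvd (?P * z) ^ p" using p by (simp add: power_mult_distrib prime_gt_0_nat dvd_power)
  have "?P dvd ((a ^ ?q + b ^ ?q) + ?P * z) ^ p - ((a ^ ?q + b ^ ?q) ^ p + (?P * z) ^ p)"
    "?P dvd (a ^ ?q + b ^ ?q) ^ p - ((a ^ ?q) ^ p + (b ^ ?q) ^ p)"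
    by (rule frobenius_add_dvd[OF p])+
  from dvd_add[OF dvd_add[OF this] pp]
  have "?P dvd ((a ^ ?q + b ^ ?q) + ?P * z) ^ p - ((a ^ ?q) ^ p + (b ^ ?q) ^ p)"
    by (simp add: algebra_simps)
  then show ?case
    unfolding z[symmetric] by (simp add: power_mult[symmetric] mult.commute)
qed simp

text \<open>Fermat's little theorem for exponents p^k: additivity of the power modulo p lets the
  integer move up or down by one, starting from 0.\<close>

lemma frobenius_power_of_int_dvd:
  assumes p: "prime p"
  shows "of_nat p dvd (of_int c ^ (p ^ k) - of_int c :: 'a :: comm_ring_1)"
proof (induction c rule: int_induct[where k = 0])
  case base
  then show ?case using p by (simp add: prime_gt_0_nat power_0_left)
next
  case (step1 i)
  from dvd_add[OF frobenius_power_add_dvd[OF p, of "of_int i :: 'a" 1 k] step1(2)]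
  show ?case by (simp add: algebra_simps)
next
  case (step2 i)
  from dvd_diff[OF step2(2) frobenius_power_add_dvd[OF p, of "of_int (i - 1) :: 'a" 1 k]]
  show ?case by (simp add: algebra_simps)
qed

section \<open>Evaluation of integer polynomials and the number of their roots\<close>

abbreviation int_scalar :: "('a, 'b) ring_scheme \<Rightarrow> int \<Rightarrow> 'a" where
  "int_scalar R c \<equiv> [c] \<cdot>\<^bsub>R\<^esub> \<one>\<^bsub>R\<^esub>"

text \<open>The homomorphism from Z[X] to R that sends X to x, in Horner form. Integer polynomials
  act as names for ring elements that make sense in every commutative ring at once.\<close>

definition int_eval :: "('a, 'b) ring_scheme \<Rightarrow> 'a \<Rightarrow> int poly \<Rightarrow> 'a" where
  "int_eval R x P = fold_coeffs (\<lambda>c y. [c] \<cdot>\<^bsub>R\<^esub> \<one>\<^bsub>R\<^esub> \<oplus>\<^bsub>R\<^esub> x \<otimes>\<^bsub>R\<^esub> y) P \<zero>\<^bsub>R\<^esub>"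

context cring
begin


lemma int_one_closed [simp]: "int_scalar R c \<in> carrier R"
  by simp

lemma int_one_0 [simp]: "int_scalar R 0 = \<zero>"
  by (simp add: add_pow_def)

lemma int_one_1 [simp]: "int_scalar R 1 = \<one>"
  by (simp add: add_pow_int_ge)

lemma int_one_add: "int_scalar R (a + b) = int_scalar R a \<oplus> int_scalar R b"
  by (simp add: add.int_pow_mult)

lemma int_one_mult: "int_scalar R (a * b) = int_scalar R a \<otimes> int_scalar R b"
proof -
  have "int_scalar R a \<otimes> int_scalar R b = [a] \<cdot> int_scalar R b"
    by (simp add: add_pow_ldistr_int)
  also have "\<dots> = int_scalar R (a * b)"
    by (simp add: add.int_pow_pow mult.commute)
  finally show ?thesis ..
qed

lemma int_one_minus: "int_scalar R (- a) = \<ominus> (int_scalar R a)"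
  by (simp add: add.int_pow_neg)

lemma int_eval_0 [simp]: "int_eval R x 0 = \<zero>"
  by (simp add: int_eval_def)

lemma int_eval_pCons [simp]:
  assumes "x \<in> carrier R"
  shows "int_eval R x (pCons a P) = int_scalar R a \<oplus> x \<otimes> int_eval R x P"
  using assms by (cases "a = 0 \<and> P = 0") (auto simp: int_eval_def fold_coeffs_pCons_eq)

lemma int_eval_closed [simp]:
  assumes "x \<in> carrier R"
  shows "int_eval R x P \<in> carrier R"
  using assms by (induction P) auto

lemma int_eval_add:
  assumes "x \<in> carrier R"
  shows "int_eval R x (P + Q) = int_eval R x P \<oplus> int_eval R x Q"
proof (induction P Q rule: poly_induct2)
  case (pCons a P b Q)
  then show ?case
    using assms by (simp add: int_one_add r_distr a_ac)
qed simp

lemma int_eval_smult: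
  assumes "x \<in> carrier R"
  shows "int_eval R x (smult c P) = int_scalar R c \<otimes> int_eval R x P"
proof (induction P)
  case (pCons a P)
  then show ?case
    using assms by (simp add: int_one_mult r_distr m_lcomm)
qed simp

lemma int_eval_mult:
  assumes "x \<in> carrier R"
  shows "int_eval R x (P * Q) = int_eval R x P \<otimes> int_eval R x Q"
proof (induction P)
  case (pCons a P)
  then show ?case
    using assms by (simp add: int_eval_add int_eval_smult l_distr m_assoc)
qed (use assms in simp)

lemma int_eval_1 [simp]: "x \<in> carrier R \<Longrightarrow> int_eval R x 1 = \<one>"
  by (simp add: one_pCons)

lemma int_eval_power:
  "x \<in> carrier R \<Longrightarrow> int_eval R x (P ^ n) = int_eval R x P [^] n"
  by (induction n) (simp_all add: int_eval_mult m_comm)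

lemma int_eval_minus:
  "x \<in> carrier R \<Longrightarrow> int_eval R x (- P) = \<ominus> int_eval R x P"
  using int_eval_smult[of x "-1" P] by (simp add: int_one_minus l_minus)

lemma int_eval_diff:
  "x \<in> carrier R \<Longrightarrow> int_eval R x (P - Q) = int_eval R x P \<ominus> int_eval R x Q"
  using int_eval_add[of x P "- Q"] by (simp add: int_eval_minus minus_eq)

lemma int_eval_monom: "x \<in> carrier R \<Longrightarrow> int_eval R x (Polynomial.monom 1 n) = x [^] n"
  by (induction n) (simp_all add: Polynomial.monom_0 Polynomial.monom_Suc m_comm)

lemma int_eval_of_int: "x \<in> carrier R \<Longrightarrow> int_eval R x (of_int c) = int_scalar R c"
  by (simp add: of_int_poly)

lemma int_eval_prod_eq_zero:
  assumes "x \<in> carrier R" "finite A" "a \<in> A" "int_eval R x (f a) = \<zero>"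
  shows "int_eval R x (\<Prod>a\<in>A. f a) = \<zero>"
  using assms by (simp add: prod.remove[of A a] int_eval_mult)

lemma int_eval_prod_eq_one:
  assumes "x \<in> carrier R" "\<And>a. a \<in> A \<Longrightarrow> int_eval R x (f a) = \<one>"
  shows "int_eval R x (\<Prod>a\<in>A. f a) = \<one>"
  using assms(2)
  by (induction A rule: infinite_finite_induct) (simp_all add: assms(1) int_eval_mult)

lemma int_eval_dvd_eq_zero:
  assumes "x \<in> carrier R" "int_scalar R (int p) = \<zero>" "of_nat p dvd P"
  shows "int_eval R x P = \<zero>"
proof -
  obtain Q where "P = of_int (int p) * Q" using assms(3) by (auto elim!: dvdE)
  then show ?thesis using assms by (simp add: int_eval_mult int_eval_of_int del: of_int_of_nat_eq)
qed

lemma int_eval_coeffs_zero: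
  assumes "x \<in> carrier R" "\<And>i. int_scalar R (Polynomial.coeff P i) = \<zero>"
  shows "int_eval R x P = \<zero>"
  using assms(2)
proof (induction P)
  case (pCons a P)
  have "int_scalar R (Polynomial.coeff P i) = \<zero>" for i
    using pCons.prems[of "Suc i"] by simp
  then show ?case using pCons pCons.prems[of 0] assms(1) by simp
qed simp

text \<open>A bridge to polynomials represented as coefficient lists, which put the leading
  coefficient in front, hence \<open>rev\<close>. It gives access to the bound on the number of
  roots.\<close>

lemma eval_map_int_coeffs:
  assumes "x \<in> carrier R"
  shows "eval (map (\<lambda>c. int_scalar R c) (rev (coeffs P))) x = int_eval R x P"
proof (induction P)
  case (pCons a P)
  have "eval (map (\<lambda>c. int_scalar R c) (rev (coeffs P)) @ [int_scalar R a]) x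
      = eval (map (\<lambda>c. int_scalar R c) (rev (coeffs P))) x \<otimes> x \<oplus> int_scalar R a"
    by (rule eval_append_aux) (use assms in auto)
  then show ?case
    using pCons assms by (cases "P = 0"; cases "a = 0") (simp_all add: m_comm a_comm)
qed simp

end

text \<open>Mapping the coefficients into the field may kill leading ones. One surviving coefficient
  keeps the normalized list nonempty, and normalizing only shortens the list, so the integral degree
  still bounds the number of roots.\<close>

lemma (in field) card_int_eval_roots_le:
  assumes nz: "int_scalar R (Polynomial.coeff P i) \<noteq> \<zero>"
  shows "finite {h \<in> carrier R. int_eval R h P = \<zero>}"
    "card {h \<in> carrier R. int_eval R h P = \<zero>} \<le> Polynomial.degree P"
proof -
  define L where "L = map (\<lambda>c. int_scalar R c) (rev (coeffs P))"
  have L: "set L \<subseteq> carrier R" by (auto simp: L_def)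
  have "normalize L \<in> carrier (poly_ring R)"
    using normalize_gives_polynomial[OF L] by (simp add: univ_poly_carrier)
  have ne: "normalize L \<noteq> []"
  proof
    assume "normalize L = []"
    then have "set L \<subseteq> {\<zero>}"
      using normalize_trick[of L] by (metis append_Nil2 set_replicate_conv_if empty_subsetI subset_refl)
    moreover have "Polynomial.coeff P i \<in> set (coeffs P)"
      using nz by (metis coeff_in_coeffs int_one_0 le_degree Polynomial.coeff_0)
    ultimately show False using nz by (auto simp: L_def)
  qed
  have "{h \<in> carrier R. int_eval R h P = \<zero>} = set_mset (roots (normalize L))"
  proof -
    have "h \<in># roots (normalize L) \<longleftrightarrow> h \<in> carrier R \<and> int_eval R h P = \<zero>" for h
      using roots_mem_iff_is_root[OF \<open>normalize L \<in> _\<close>] ne eval_normalize[OF L]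
        eval_map_int_coeffs[of h P]
      by (auto simp: is_root_def L_def)
    then show ?thesis by auto
  qed
  moreover have "size (roots (normalize L)) \<le> Polynomial.degree P"
  proof -
    have "P \<noteq> 0" using nz by auto
    then have "length L = Suc (Polynomial.degree P)" by (simp add: L_def length_coeffs_degree)
    then show ?thesis
      using size_roots_le_degree[OF \<open>normalize L \<in> _\<close>] normalize_length_le[of L] by simp
  qed
  moreover have "card (set_mset m) \<le> size m" for m :: "'a multiset"
    by (metis mset_set_set_mset_msubset size_mset_mono size_mset_set)
  ultimately show "finite {h \<in> carrier R. int_eval R h P = \<zero>}"
    "card {h \<in> carrier R. int_eval R h P = \<zero>} \<le> Polynomial.degree P"
    by (auto intro: order_trans)
qed

section \<open>Characteristic and order of a finite field\<close>

lemma (in field) int_one_eq_zero_iff: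
  assumes p: "prime p" and char: "int_scalar R (int p) = \<zero>"
  shows "int_scalar R c = \<zero> \<longleftrightarrow> int p dvd c"
proof
  assume "int p dvd c"
  then show "int_scalar R c = \<zero>" using char by (auto simp: int_one_mult elim!: dvdE)
next
  assume c: "int_scalar R c = \<zero>"
  show "int p dvd c"
  proof (rule ccontr)
    assume "\<not> int p dvd c"
    then have "coprime (int p) c" using p by (simp add: prime_imp_coprime)
    then obtain u v where "u * int p + v * c = 1"
      using bezout_int[of "int p" c] by (auto simp: coprime_iff_gcd_eq_1)
    then have "\<one> = int_scalar R (u * int p + v * c)" by simp
    also have "\<dots> = \<zero>" by (simp add: int_one_add int_one_mult c char del: add.int_pow_pow)
    finally show False by simp
  qed
qed

text \<open>Cauchy's theorem for the additive group: a subgroup of order r contains some nonzero h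
  with r h = 0. Reading r h as (r 1) h and cancelling h gives r 1 = 0.\<close>

lemma (in field) prime_dvd_card_char:
  assumes fin: "finite (carrier R)" and r: "prime r" "r dvd card (carrier R)"
  shows "int_scalar R (int r) = \<zero>"
proof -
  obtain m where "card (carrier R) = r ^ 1 * m" using r by auto
  then obtain H where H: "subgroup H (add_monoid R)" "card H = r"
    using sylow_thm[of r "add_monoid R" 1 m] r fin add.is_group by (auto simp: Coset.order_def)
  interpret H: subgroup H "add_monoid R" by fact
  interpret G: group "(add_monoid R)\<lparr>carrier := H\<rparr>"
    using H.subgroup_is_group add.is_group by blast
  have "card H \<ge> 2" using H r by (simp add: prime_ge_2_nat)
  then have "\<not> H \<subseteq> {\<zero>}"
    using card_mono[of "{\<zero>}" H] by auto
  then obtain h where h: "h \<in> H" "h \<noteq> \<zero>" by auto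
  have hR: "h \<in> carrier R" using H.subset h by auto
  have "h [^]\<^bsub>(add_monoid R)\<lparr>carrier := H\<rparr>\<^esub> r = \<zero>"
    using G.pow_order_eq_1[of h] h H by (simp add: Coset.order_def)
  then have "[r] \<cdot> h = \<zero>"
    using add.nat_pow_consistent[of r h H] by (simp add: add_pow_def)
  then have "[int r] \<cdot> h = \<zero>" by (simp add: add_pow_int_ge)
  then have "int_scalar R (int r) \<otimes> h = \<zero>"
    using hR by (simp add: add_pow_ldistr_int)
  then show ?thesis using h hR integral by (metis int_one_closed)
qed

text \<open>Every prime divisor of the order annihilates the identity, while multiples of p are the
  only integers that do. Hence p is the only prime divisor of the order.\<close>

lemma finite_field_card:
  fixes F (structure)
  assumes F: "field F" and fin: "finite (carrier F)"
  obtains p k where "prime p" "k > 0" "card (carrier F) = p ^ k" "int_scalar F (int p) = \<zero>"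
proof -
  interpret field F by fact
  let ?n = "card (carrier F)"
  have n: "?n \<ge> 2" using field_card_ge_2 F fin by blast
  then obtain p where p: "prime p" "p dvd ?n"
    by (metis prime_factor_nat not_numeral_le_zero Suc_1 Suc_n_not_le_n One_nat_def)
  have char: "int_scalar F (int p) = \<zero>" using prime_dvd_card_char fin p by blast
  obtain m where m: "?n = p ^ multiplicity p ?n * m" "\<not> p dvd m"
    using multiplicity_decompose'[of ?n p] n p by (metis not_numeral_le_zero not_prime_unit)
  have "m = 1"
  proof (rule ccontr)
    assume "m \<noteq> 1"
    then obtain r where r: "prime r" "r dvd m" using prime_factor_nat by blast
    then have "r dvd ?n" using m(1) by (metis dvd_mult)
    then have "int p dvd int r"
      using prime_dvd_card_char[OF fin r(1)] int_one_eq_zero_iff[OF p(1) char] by blast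
    then have "p = r" using p r by (simp add: primes_dvd_imp_eq)
    then show False using r m by simp
  qed
  then have "?n = p ^ multiplicity p ?n" using m by simp
  moreover from this n have "multiplicity p ?n > 0" by (cases "multiplicity p ?n") auto
  ultimately show ?thesis using that p char by metis
qed

lemma (in field) power_card_eq:
  assumes fin: "finite (carrier R)" and x: "x \<in> carrier R"
  shows "x [^] card (carrier R) = x"
proof (cases "x = \<zero>")
  case True
  have "card (carrier R) \<noteq> 0" using fin x by auto
  then show ?thesis using True by (cases "card (carrier R)") auto
next
  case False
  interpret G: group "mult_of R" by (rule field_mult_group)
  have "x [^]\<^bsub>mult_of R\<^esub> order (mult_of R) = \<one>"
    using G.pow_order_eq_1[of x] x False by simp
  then have *: "x [^] (card (carrier R) - 1) = \<one>"
    using order_mult_of[OF fin] by (simp add: Multiplicative_Group.nat_pow_mult_of Coset.order_def)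
  have "card (carrier R) = Suc (card (carrier R) - 1)"
    using field_card_ge_2[OF field_axioms fin] by simp
  then show ?thesis using * x by (metis l_one nat_pow_Suc)
qed

section \<open>Conjugates, generators and isomorphisms of finite fields\<close>

abbreviation frobenius_poly :: "nat \<Rightarrow> int poly" where
  "frobenius_poly q \<equiv> Polynomial.monom 1 q - [:0, 1:]"

lemma monic_frobenius_poly:
  assumes "q \<ge> 2"
  shows "Polynomial.degree (frobenius_poly q) = q"
    and "Polynomial.coeff (frobenius_poly q) q = 1"
proof -
  show "Polynomial.degree (frobenius_poly q) = q"
    using assms
    by (subst diff_conv_add_uminus, subst degree_add_eq_left) (simp_all add: degree_monom_eq)
  show "Polynomial.coeff (frobenius_poly q) q = 1"
    using assms by (simp add: coeff_pCons split: nat.splits)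
qed

text \<open>Pseudo-division scales the dividend by a power of the leading coefficient of the
  divisor. That coefficient is 1 here, so this is genuine division over the integers.\<close>

lemma frobenius_poly_division:
  fixes P :: "int poly"
  assumes q: "q \<ge> 2"
  obtains A B where "P = frobenius_poly q * A + B" "Polynomial.degree B < q"
proof -
  let ?M = "frobenius_poly q"
  have "?M \<noteq> 0" using monic_frobenius_poly(2)[OF q] by (metis Polynomial.coeff_0 zero_neq_one)
  moreover obtain A B where "pseudo_divmod P ?M = (A, B)" by fastforce
  ultimately have "P = ?M * A + B" "B = 0 \<or> Polynomial.degree B < q"
    using pseudo_divmod[of ?M P A B] monic_frobenius_poly[OF q] by auto
  then show ?thesis using that[of A B] q by auto
qed

lemma int_eval_frobenius_poly:
  fixes F (structure)
  assumes "field F" "finite (carrier F)" "g \<in> carrier F"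
  shows "int_eval F g (frobenius_poly (card (carrier F))) = \<zero>"
proof -
  interpret field F by fact
  show ?thesis
    using assms power_card_eq by (simp add: int_eval_diff int_eval_monom minus_eq r_neg)
qed

text \<open>Division by the monic polynomial \<open>X\<^sup>q - X\<close> leaves a remainder with too many roots, so all its
  coefficients are divisible by the common characteristic.\<close>
lemma int_eval_vanish_transfer:
  assumes F: "field F" "finite (carrier F)" and K: "field K" "finite (carrier K)"
    and card: "card (carrier F) = card (carrier K)"
    and p: "prime p" "int_scalar F (int p) = \<zero>\<^bsub>F\<^esub>" "int_scalar K (int p) = \<zero>\<^bsub>K\<^esub>"
    and van: "\<And>h. h \<in> carrier K \<Longrightarrow> int_eval K h Q = \<zero>\<^bsub>K\<^esub>"
    and g: "g \<in> carrier F"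
  shows "int_eval F g Q = \<zero>\<^bsub>F\<^esub>"
proof -
  interpret F: field F by fact
  interpret K: field K by fact
  define q where "q = card (carrier K)"
  have q: "q \<ge> 2" using field_card_ge_2 K by (simp add: q_def)
  define M where "M = frobenius_poly q"
  obtain A B where Q: "Q = M * A + B" and B: "Polynomial.degree B < q"
    unfolding M_def using frobenius_poly_division[OF q] by blast
  have MF: "int_eval F g M = \<zero>\<^bsub>F\<^esub>"
    using int_eval_frobenius_poly[OF F g] card by (simp add: M_def q_def)
  have "int_eval K h B = \<zero>\<^bsub>K\<^esub>" if h: "h \<in> carrier K" for h
  proof -
    have "int_eval K h M = \<zero>\<^bsub>K\<^esub>"
      using int_eval_frobenius_poly[OF K h] by (simp add: M_def q_def)
    then show ?thesis
      using van[OF h] h by (simp add: Q K.int_eval_add K.int_eval_mult)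
  qed
  then have roots: "{h \<in> carrier K. int_eval K h B = \<zero>\<^bsub>K\<^esub>} = carrier K" by auto
  have "int_scalar K (Polynomial.coeff B i) = \<zero>\<^bsub>K\<^esub>" for i
  proof (rule ccontr)
    assume nz: "int_scalar K (Polynomial.coeff B i) \<noteq> \<zero>\<^bsub>K\<^esub>"
    then have "B \<noteq> 0" by auto
    then show False
      using B K.card_int_eval_roots_le(2)[OF nz] unfolding roots q_def by simp
  qed
  then have "int p dvd Polynomial.coeff B i" for i
    using K.int_one_eq_zero_iff[OF p(1,3)] by blast
  then have "int_scalar F (Polynomial.coeff B i) = \<zero>\<^bsub>F\<^esub>" for i
    using F.int_one_eq_zero_iff[OF p(1,2)] by blast
  then have "int_eval F g B = \<zero>\<^bsub>F\<^esub>"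
    using F.int_eval_coeffs_zero g by blast
  then show ?thesis
    using MF g by (simp add: Q F.int_eval_add F.int_eval_mult)
qed

text \<open>If for every \<open>h\<close> some \<open>P\<^sub>h\<close> vanished at \<open>g\<close> but not at \<open>h\<close>, then \<open>\<Prod>\<^sub>h (1 - P\<^sub>h\<^bsup>q-1\<^esup>)\<close> would
  vanish on all of \<open>K\<close> and take the value 1 at \<open>g\<close>.\<close>
lemma exists_conjugate:
  assumes F: "field F" "finite (carrier F)" and K: "field K" "finite (carrier K)"
    and card: "card (carrier F) = card (carrier K)"
    and p: "prime p" "int_scalar F (int p) = \<zero>\<^bsub>F\<^esub>" "int_scalar K (int p) = \<zero>\<^bsub>K\<^esub>"
    and g: "g \<in> carrier F"
  shows "\<exists>h\<in>carrier K. \<forall>P. int_eval F g P = \<zero>\<^bsub>F\<^esub> \<longrightarrow> int_eval K h P = \<zero>\<^bsub>K\<^esub>"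
proof (rule ccontr)
  interpret F: field F by fact
  interpret K: field K by fact
  assume "\<not> ?thesis"
  then obtain P where P: "\<And>h. h \<in> carrier K \<Longrightarrow>
      int_eval F g (P h) = \<zero>\<^bsub>F\<^esub> \<and> int_eval K h (P h) \<noteq> \<zero>\<^bsub>K\<^esub>"
    by metis
  define n where "n = card (carrier K) - 1"
  have n: "n > 0" "card (carrier K) = Suc n" using field_card_ge_2[OF K] by (simp_all add: n_def)
  define Q where "Q = (\<Prod>h\<in>carrier K. 1 - P h ^ n)"
  have "int_eval K h Q = \<zero>\<^bsub>K\<^esub>" if h: "h \<in> carrier K" for h
    unfolding Q_def
  proof (rule K.int_eval_prod_eq_zero[OF h K(2) h])
    let ?a = "int_eval K h (P h)"
    have a: "?a \<in> carrier K" "?a \<noteq> \<zero>\<^bsub>K\<^esub>" using P h by auto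
    have "?a [^]\<^bsub>K\<^esub> n \<otimes>\<^bsub>K\<^esub> ?a = \<one>\<^bsub>K\<^esub> \<otimes>\<^bsub>K\<^esub> ?a"
      using K.power_card_eq[OF K(2) a(1)] a unfolding n(2) by simp
    then have "?a [^]\<^bsub>K\<^esub> n = \<one>\<^bsub>K\<^esub>"
      using a K.m_rcancel K.nat_pow_closed K.one_closed by blast
    then show "int_eval K h (1 - P h ^ n) = \<zero>\<^bsub>K\<^esub>"
      using h by (simp add: K.int_eval_diff K.int_eval_power K.minus_eq K.r_neg)
  qed
  then have "int_eval F g Q = \<zero>\<^bsub>F\<^esub>"
    using int_eval_vanish_transfer[OF F K card p _ g] by blast
  moreover have "int_eval F g Q = \<one>\<^bsub>F\<^esub>"
    unfolding Q_def
  proof (rule F.int_eval_prod_eq_one[OF g])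
    fix h assume "h \<in> carrier K"
    then show "int_eval F g (1 - P h ^ n) = \<one>\<^bsub>F\<^esub>"
      using P g n by (simp add: F.int_eval_diff F.int_eval_power F.nat_pow_zero F.minus_eq)
  qed
  ultimately show False by simp
qed

text \<open>A generator of the cyclic multiplicative group makes every nonzero element the value of
  a monomial. For order p^k, the exponent range of the last conclusion contains all p^i with i < k,
  which later separates the powers of the Frobenius map.\<close>

lemma (in field) finite_field_generator:
  assumes fin: "finite (carrier R)"
  obtains g where "g \<in> carrier R"
    "\<And>a. a \<in> carrier R \<Longrightarrow> \<exists>P. int_eval R g P = a"
    "inj_on (\<lambda>i::nat. g [^] i) {1..card (carrier R) - 1}"
proof -
  let ?n = "card (carrier R) - 1"
  have n: "?n > 0" "card (carrier R) = Suc ?n"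
    using field_card_ge_2[OF field_axioms fin] by simp_all
  obtain g where g: "g \<in> carrier (mult_of R)"
    and gen: "carrier (mult_of R) = {g [^] i | i::nat. i \<in> UNIV}"
    using finite_field_mult_group_has_gen[OF fin] by blast
  have gR: "g \<in> carrier R" "g \<noteq> \<zero>" using g by auto
  have "\<exists>P. int_eval R g P = a" if "a \<in> carrier R" for a
  proof (cases "a = \<zero>")
    case True
    then show ?thesis by (intro exI[of _ 0]) simp
  next
    case False
    then have "a \<in> carrier (mult_of R)" using that by simp
    then obtain i :: nat where "a = g [^] i" unfolding gen by blast
    then show ?thesis using int_eval_monom gR by blast
  qed
  moreover have "inj_on (\<lambda>i::nat. g [^] i) {1..?n}"
  \<comment> \<open>Injectivity by counting: reducing exponents modulo \<open>?n\<close>, with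
    residue 0 replaced by \<open>?n\<close>, shows that this range already reaches all
    \<open>?n\<close> nonzero elements.\<close>
  proof (rule eq_card_imp_inj_on)
    have "g [^] ?n \<otimes> g = \<one> \<otimes> g"
      using power_card_eq[OF fin gR(1)] gR by (subst (asm) n(2)) simp
    then have gn: "g [^] ?n = \<one>" using gR m_rcancel by blast
    have "(\<lambda>i::nat. g [^] i) ` {1..?n} = carrier (mult_of R)"
    proof (intro equalityI subsetI)
      fix a assume "a \<in> carrier (mult_of R)"
      then obtain i :: nat where i: "a = g [^] i" unfolding gen by blast
      have "g [^] i = g [^] (?n * (i div ?n) + i mod ?n)" by simp
      also have "\<dots> = (g [^] ?n) [^] (i div ?n) \<otimes> g [^] (i mod ?n)"
        using gR by (simp only: nat_pow_mult[symmetric] nat_pow_pow)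
      also have "\<dots> = g [^] (i mod ?n)" using gR by (simp only: gn) simp
      finally have a: "a = g [^] (i mod ?n)" using i by simp
      show "a \<in> (\<lambda>i::nat. g [^] i) ` {1..?n}"
      proof (cases "i mod ?n = 0")
        case True
        then have "a = g [^] ?n" using a gn by simp
        then show ?thesis using n by (intro image_eqI) auto
      next
        case False
        have "i mod ?n < ?n" using n by simp
        then show ?thesis using a False by (intro image_eqI[of _ _ "i mod ?n"]) auto
      qed
    qed (use gen in blast)
    moreover have "card (carrier (mult_of R)) = ?n" using fin by simp
    ultimately show "card ((\<lambda>i::nat. g [^] i) ` {1..?n}) = card {1..?n}" by simp
  qed simp
  ultimately show ?thesis using that gR by blast
qed

text \<open>Let g generate F and let h in K satisfy every relation that holds at g. Then P(g) |->
  P(h) is well defined and multiplicative, it is injective because F is a field, and it is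
  surjective because the orders agree.\<close>

lemma exists_field_iso:
  assumes F: "field F" "finite (carrier F)" and K: "field K" "finite (carrier K)"
    and card: "card (carrier F) = card (carrier K)"
    and p: "prime p" "int_scalar F (int p) = \<zero>\<^bsub>F\<^esub>" "int_scalar K (int p) = \<zero>\<^bsub>K\<^esub>"
  shows "\<exists>h. h \<in> ring_iso F K"
proof -
  interpret F: field F by fact
  interpret K: field K by fact
  obtain g where g: "g \<in> carrier F" and gen: "\<And>a. a \<in> carrier F \<Longrightarrow> \<exists>P. int_eval F g P = a"
    using F.finite_field_generator F(2) by metis
  obtain h where h: "h \<in> carrier K"
    and van: "\<And>P. int_eval F g P = \<zero>\<^bsub>F\<^esub> \<Longrightarrow> int_eval K h P = \<zero>\<^bsub>K\<^esub>"
    using exists_conjugate[OF F K card p g] by blast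
  define r where "r a = (SOME P. int_eval F g P = a)" for a
  have r: "int_eval F g (r a) = a" if "a \<in> carrier F" for a
    unfolding r_def using gen[OF that] by (rule someI_ex)
  have wd: "int_eval K h P = int_eval K h Q" if "int_eval F g P = int_eval F g Q" for P Q
  proof -
    have "int_eval F g (P - Q) = \<zero>\<^bsub>F\<^esub>"
      using that g by (simp add: F.int_eval_diff F.minus_eq F.r_neg)
    then show ?thesis
      using van[of "P - Q"] h by (simp add: K.int_eval_diff K.r_right_minus_eq)
  qed
  define f where "f a = int_eval K h (r a)" for a
  have f: "f (int_eval F g P) = int_eval K h P" for P
    unfolding f_def by (rule wd) (simp add: r g)
  have inj: "inj_on f (carrier F)"
  proof (rule inj_onI)
    fix a b assume ab: "a \<in> carrier F" "b \<in> carrier F" "f a = f b"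
    show "a = b"
    proof (rule ccontr)
      assume "a \<noteq> b"
      then have d: "a \<ominus>\<^bsub>F\<^esub> b \<in> carrier F" "a \<ominus>\<^bsub>F\<^esub> b \<noteq> \<zero>\<^bsub>F\<^esub>"
        using ab by (simp_all add: F.r_right_minus_eq)
      then obtain c where c: "c \<in> carrier F" "(a \<ominus>\<^bsub>F\<^esub> b) \<otimes>\<^bsub>F\<^esub> c = \<one>\<^bsub>F\<^esub>"
        using F.field_Units F.Units_r_inv_ex by blast
      \<comment> \<open>If a and b had the same image, the relation (a - b) c = 1 would be
        transported to 0 = 1 in K.\<close>
      have "int_eval F g ((r a - r b) * r c) = int_eval F g 1"
        using ab c g r by (simp add: F.int_eval_mult F.int_eval_diff)
      then have "int_eval K h ((r a - r b) * r c) = int_eval K h 1" by (rule wd)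
      moreover have "int_eval K h (r a - r b) = \<zero>\<^bsub>K\<^esub>"
        using ab h by (simp add: K.int_eval_diff f_def K.minus_eq K.r_neg)
      ultimately show False using h by (simp add: K.int_eval_mult)
    qed
  qed
  have cl: "f a \<in> carrier K" for a using h by (simp add: f_def)
  have "f ` carrier F = carrier K"
    using cl inj card K(2) by (intro card_subset_eq) (auto simp: card_image)
  then have "bij_betw f (carrier F) (carrier K)" using inj by (simp add: bij_betw_def)
  moreover have "f (a \<otimes>\<^bsub>F\<^esub> b) = f a \<otimes>\<^bsub>K\<^esub> f b" "f (a \<oplus>\<^bsub>F\<^esub> b) = f a \<oplus>\<^bsub>K\<^esub> f b"
    if "a \<in> carrier F" "b \<in> carrier F" for a b
  proof -
    show "f (a \<otimes>\<^bsub>F\<^esub> b) = f a \<otimes>\<^bsub>K\<^esub> f b"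
      using f[of "r a * r b"] that g h r by (simp add: F.int_eval_mult K.int_eval_mult f_def)
    show "f (a \<oplus>\<^bsub>F\<^esub> b) = f a \<oplus>\<^bsub>K\<^esub> f b"
      using f[of "r a + r b"] that g h r by (simp add: F.int_eval_add K.int_eval_add f_def)
  qed
  ultimately have "f \<in> ring_iso F K"
    using f[of 1] g h cl by (intro ring_iso_memI) auto
  then show ?thesis by blast
qed

text \<open>This is why a homomorphism is determined by its value at a generator, and why that value
  satisfies all the relations of the generator.\<close>

lemma ring_hom_int_eval:
  assumes "cring R" "cring S" and h: "h \<in> ring_hom R S" and x: "x \<in> carrier R"
  shows "h (int_eval R x P) = int_eval S (h x) P"
proof -
  interpret R: cring R by fact
  interpret S: cring S by fact
  note hh = ring_hom_memE[OF h]
  have z: "h \<zero>\<^bsub>R\<^esub> = \<zero>\<^bsub>S\<^esub>" using ring_hom_zero[OF h] R.ring_axioms S.ring_axioms by blast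
  have "h \<in> hom (add_monoid R) (add_monoid S)" using hh by (auto simp: hom_def)
  then have sc: "h (int_scalar R c) = int_scalar S c" for c
    using hom_int_pow[of h "add_monoid R" "add_monoid S" "\<one>\<^bsub>R\<^esub>" c] R.add.is_group S.add.is_group hh(4)
    by (simp add: add_pow_def)
  show ?thesis
  proof (induction P)
    case (pCons a P)
    have cl: "int_scalar R a \<in> carrier R" "int_eval R x P \<in> carrier R"
      "x \<otimes>\<^bsub>R\<^esub> int_eval R x P \<in> carrier R"
      using x by auto
    show ?case
      using x hh(1)[OF x] hh(2)[OF x cl(2)] hh(3)[OF cl(1,3)] pCons by (simp add: sc)
  qed (simp add: z)
qed

text \<open>Pigeonhole: there are \<open>p\<^bsup>k+1\<^esup>\<close> polynomials of degree at most \<open>k\<close> with coefficients in \<open>{0..<p}\<close>.\<close>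
lemma exists_annihilating_poly:
  fixes F (structure)
  assumes F: "field F" "finite (carrier F)" and card: "card (carrier F) = p ^ k"
    and p: "prime p" and g: "g \<in> carrier F"
  obtains P i where "Polynomial.degree P \<le> k" "int_eval F g P = \<zero>" "\<not> int p dvd Polynomial.coeff P i"
proof -
  interpret field F by fact
  define S :: "(nat \<Rightarrow> int) set" where "S = {..k} \<rightarrow>\<^sub>E {0..<int p}"
  define T :: "(nat \<Rightarrow> int) \<Rightarrow> int poly" where "T f = (\<Sum>i\<le>k. Polynomial.monom (f i) i)" for f
  have cT: "Polynomial.coeff (T f) i = (if i \<le> k then f i else 0)" for f i
    by (simp add: T_def coeff_sum)
  have "card S = p ^ Suc k" by (simp add: S_def card_PiE)
  moreover have "p \<ge> 2" using p by (simp add: prime_ge_2_nat)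
  ultimately have "card S > card (carrier F)" using card by simp
  moreover have "(\<lambda>f. int_eval F g (T f)) ` S \<subseteq> carrier F" using g by auto
  ultimately have "\<not> inj_on (\<lambda>f. int_eval F g (T f)) S"
    using card_inj_on_le[of _ S "carrier F"] F(2) by fastforce
  then obtain f f' where f: "f \<in> S" "f' \<in> S" "f \<noteq> f'" "int_eval F g (T f) = int_eval F g (T f')"
    by (auto simp: inj_on_def)
  then obtain i where i: "i \<le> k" "f i \<noteq> f' i"
    by (metis PiE_ext S_def atMost_iff)
  have "\<not> int p dvd f i - f' i"
  proof
    assume "int p dvd f i - f' i"
    then have "f i mod int p = f' i mod int p" by (simp add: mod_eq_dvd_iff)
    moreover have "f i \<in> {0..<int p}" "f' i \<in> {0..<int p}" using f i by (auto simp: S_def PiE_def)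
    ultimately show False using i by simp
  qed
  then have "\<not> int p dvd Polynomial.coeff (T f - T f') i" using i by (simp add: cT)
  moreover have "Polynomial.degree (T f - T f') \<le> k"
    by (rule degree_le) (simp add: cT)
  moreover have "int_eval F g (T f - T f') = \<zero>"
    using f g by (simp add: int_eval_diff minus_eq r_neg)
  ultimately show ?thesis using that by blast
qed

text \<open>Additivity is lifted to Z[X]: write a = P(g) and b = Q(g), use the congruence modulo p
  there, and evaluate. Injectivity holds because raising further to the power p^(k-i) gives back c^q
  = c, where q = p^k.\<close>

lemma frobenius_power_iso:
  fixes F (structure)
  assumes F: "field F" "finite (carrier F)" and card: "card (carrier F) = p ^ k"
    and p: "prime p" "int_scalar F (int p) = \<zero>" and i: "i \<le> k"
  shows "(\<lambda>a. a [^] (p ^ i)) \<in> ring_iso F F"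
proof -
  interpret field F by fact
  obtain g where g: "g \<in> carrier F" and gen: "\<And>a. a \<in> carrier F \<Longrightarrow> \<exists>P. int_eval F g P = a"
    using finite_field_generator F(2) by metis
  have add: "(a \<oplus> b) [^] (p ^ i) = a [^] (p ^ i) \<oplus> b [^] (p ^ i)"
    if "a \<in> carrier F" "b \<in> carrier F" for a b
  proof -
    obtain P Q where PQ: "int_eval F g P = a" "int_eval F g Q = b" using gen \<open>a \<in> _\<close> \<open>b \<in> _\<close> by blast
    have "int_eval F g ((P + Q) ^ (p ^ i) - (P ^ (p ^ i) + Q ^ (p ^ i))) = \<zero>"
      by (rule int_eval_dvd_eq_zero[OF g p(2) frobenius_power_add_dvd[OF p(1)]])
    then show ?thesis
      using PQ g that by (simp add: int_eval_diff int_eval_power int_eval_add)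
  qed
  have inj: "inj_on (\<lambda>a. a [^] (p ^ i)) (carrier F)"
  proof (rule inj_onI)
    fix a b assume ab: "a \<in> carrier F" "b \<in> carrier F" "a [^] (p ^ i) = b [^] (p ^ i)"
    have "c = (c [^] (p ^ i)) [^] (p ^ (k - i))" if "c \<in> carrier F" for c
      using power_card_eq[OF F(2) that] that i by (simp add: nat_pow_pow card flip: power_add)
    then show "a = b" using ab by metis
  qed
  then have "bij_betw (\<lambda>a. a [^] (p ^ i)) (carrier F) (carrier F)"
    using F(2) by (auto simp: bij_betw_def intro!: endo_inj_surj[THEN equalityD2, THEN subsetD])
  then show ?thesis
    by (intro ring_iso_memI) (auto simp: add nat_pow_distrib)
qed

text \<open>An isomorphism is determined by the image of g, a root in K of a polynomial of degree at
  most k that stays nonzero modulo p. Conversely, composing one isomorphism with the first k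
  Frobenius powers gives distinct maps, since the elements g^(p^j) differ. Extensional functions are
  counted because values off the carrier would otherwise be arbitrary.\<close>

theorem card_field_isos:
  assumes F: "field F" "finite (carrier F)" and K: "field K" "finite (carrier K)"
    and cF: "card (carrier F) = p ^ k" and cK: "card (carrier K) = p ^ k"
    and p: "prime p" and k: "k > 0"
  shows "card (ring_iso F K \<inter> extensional (carrier F)) = k"
proof -
  interpret F: field F by fact
  interpret K: field K by fact
  have pF: "int_scalar F (int p) = \<zero>\<^bsub>F\<^esub>"
    using F.prime_dvd_card_char[OF F(2) p] cF k by simp
  have pK: "int_scalar K (int p) = \<zero>\<^bsub>K\<^esub>"
    using K.prime_dvd_card_char[OF K(2) p] cK k by simp
  obtain g where g: "g \<in> carrier F" and gen: "\<And>a. a \<in> carrier F \<Longrightarrow> \<exists>P. int_eval F g P = a"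
    and gi: "inj_on (\<lambda>i::nat. g [^]\<^bsub>F\<^esub> i) {1..p ^ k - 1}"
    using F.finite_field_generator F(2) cF by metis
  let ?I = "ring_iso F K \<inter> extensional (carrier F)"
  obtain P i where P: "Polynomial.degree P \<le> k" "int_eval F g P = \<zero>\<^bsub>F\<^esub>"
    "\<not> int p dvd Polynomial.coeff P i"
    using exists_annihilating_poly[OF F cF p g] by blast
  have nz: "int_scalar K (Polynomial.coeff P i) \<noteq> \<zero>\<^bsub>K\<^esub>"
    using P(3) K.int_one_eq_zero_iff[OF p pK] by blast
  have homev: "h (int_eval F g P) = int_eval K (h g) P" if "h \<in> ring_iso F K" for h P
    using ring_hom_int_eval[OF F.is_cring K.is_cring _ g] that by (simp add: ring_iso_def)
  have inj: "inj_on (\<lambda>h. h g) ?I"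
  proof (rule inj_onI)
    fix h h' assume h: "h \<in> ?I" "h' \<in> ?I" "h g = h' g"
    have "h a = h' a" if "a \<in> carrier F" for a
      using gen[OF that] homev[of h] homev[of h'] h by (metis IntD1)
    then show "h = h'" using h by (intro extensionalityI[of _ "carrier F"]) auto
  qed
  have sub': "(\<lambda>h. h g) ` ?I \<subseteq> {x \<in> carrier K. int_eval K x P = \<zero>\<^bsub>K\<^esub>}"
  proof safe
    fix h assume h: "h \<in> ring_iso F K"
    show "h g \<in> carrier K" using ring_iso_memE(1)[OF h g] .
    show "int_eval K (h g) P = \<zero>\<^bsub>K\<^esub>"
      using homev[OF h, of P] P(2) ring_iso_zero[OF F.ring_axioms K.ring_axioms h] by simp
  qed
  have "card ?I \<le> card {x \<in> carrier K. int_eval K x P = \<zero>\<^bsub>K\<^esub>}"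
    using inj sub' K.card_int_eval_roots_le(1)[OF nz] by (rule card_inj_on_le)
  have finI: "finite ?I"
    by (rule finite_imageD[OF finite_subset[OF sub' K.card_int_eval_roots_le(1)[OF nz]] inj])
  have le: "card ?I \<le> k"
    using \<open>card ?I \<le> _\<close> K.card_int_eval_roots_le(2)[OF nz] P(1) by linarith
  obtain \<psi> where \<psi>: "\<psi> \<in> ring_iso F K"
    using exists_field_iso[OF F K _ p pF pK] cF cK by auto
  define \<phi> where "\<phi> j = restrict (\<lambda>a. \<psi> (a [^]\<^bsub>F\<^esub> (p ^ j))) (carrier F)" for j :: nat
  have "\<phi> j \<in> ?I" if "j < k" for j
  proof -
    have "\<psi> \<circ> (\<lambda>a. a [^]\<^bsub>F\<^esub> (p ^ j)) \<in> ring_iso F K"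
      using ring_iso_set_trans[OF frobenius_power_iso[OF F cF p pF] \<psi>, of j] that by simp
    then have "\<phi> j \<in> ring_iso F K"
      by (rule F.ring_iso_restrict) (simp add: \<phi>_def)
    then show ?thesis by (simp add: \<phi>_def)
  qed
  then have sub: "\<phi> ` {..<k} \<subseteq> ?I" by auto
  have "inj_on \<phi> {..<k}"
  proof (rule inj_onI)
    fix i j assume ij: "i \<in> {..<k}" "j \<in> {..<k}" "\<phi> i = \<phi> j"
    have "\<psi> (g [^]\<^bsub>F\<^esub> (p ^ i)) = \<psi> (g [^]\<^bsub>F\<^esub> (p ^ j))"
      using fun_cong[OF ij(3), of g] g by (simp add: \<phi>_def)
    then have eq: "g [^]\<^bsub>F\<^esub> (p ^ i) = g [^]\<^bsub>F\<^esub> (p ^ j)"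
      using inj_onD[OF bij_betw_imp_inj_on[OF ring_iso_memE(5)[OF \<psi>]]] g by blast
    have p1: "p > 1" by (rule prime_gt_1_nat[OF p])
    have "p ^ l \<in> {1..p ^ k - 1}" if "l < k" for l
    proof -
      have "p ^ l < p ^ k" using that p1 by (rule power_strict_increasing)
      moreover have "p ^ l > 0" using p1 by simp
      ultimately show ?thesis unfolding atLeastAtMost_iff by linarith
    qed
    then have "p ^ i = p ^ j" using inj_onD[OF gi eq] ij by simp
    then show "i = j" using p1 power_inject_exp by blast
  qed
  then have "card (\<phi> ` {..<k}) = k" by (simp add: card_image)
  then have "k \<le> card ?I" using card_mono[OF finI sub] by simp
  with le show ?thesis by simp
qed

section \<open>The ideal (p, X^q - X) of Z[X] and the existence of finite fields\<close>

definition int_poly_ring :: "int poly ring" where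
  "int_poly_ring = \<lparr>carrier = UNIV, monoid.mult = (*), one = 1, ring.zero = 0, ring.add = (+)\<rparr>"

lemma int_poly_ring_simps [simp]:
  "carrier int_poly_ring = UNIV" "P \<otimes>\<^bsub>int_poly_ring\<^esub> Q = P * Q" "\<one>\<^bsub>int_poly_ring\<^esub> = 1"
  "\<zero>\<^bsub>int_poly_ring\<^esub> = 0" "P \<oplus>\<^bsub>int_poly_ring\<^esub> Q = P + Q"
  by (simp_all add: int_poly_ring_def)

lemma cring_int_poly_ring: "cring int_poly_ring"
proof (rule cringI)
  show "abelian_group int_poly_ring"
    by (rule abelian_groupI) (auto simp: algebra_simps intro: exI[of _ "- _"])
  show "comm_monoid int_poly_ring"
    by (rule comm_monoidI) (auto simp: algebra_simps)
qed (simp add: algebra_simps)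

text \<open>Combined with \<open>ring_hom_int_eval\<close>, this identifies each homomorphism out of
  Z[X] with evaluation at the image of X.\<close>

lemma int_eval_int_poly_ring: "int_eval int_poly_ring [:0, 1:] P = P"
proof -
  interpret Z: cring int_poly_ring by (rule cring_int_poly_ring)
  have sc: "int_scalar int_poly_ring c = of_int c" for c
  proof (induction c rule: int_induct[where k = 0])
    case (step1 i)
    then show ?case using Z.int_one_add[of i 1] by simp
  next
    case (step2 i)
    then show ?case using Z.int_one_add[of "i - 1" 1] by (simp add: algebra_simps)
  qed (use Z.int_one_0 in simp)
  show ?thesis
    by (induction P) (simp_all add: sc[simplified] of_int_poly Z.int_eval_0[simplified])
qed

definition frobenius_ideal :: "nat \<Rightarrow> nat \<Rightarrow> int poly set" where
  "frobenius_ideal p q = {P. \<exists>A B. P = of_nat p * A + frobenius_poly q * B}"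

lemma frobenius_idealI:
  "P = of_nat p * A + frobenius_poly q * B \<Longrightarrow> P \<in> frobenius_ideal p q"
  by (auto simp: frobenius_ideal_def)

lemma frobenius_ideal_add:
  assumes "P \<in> frobenius_ideal p q" "Q \<in> frobenius_ideal p q"
  shows "P + Q \<in> frobenius_ideal p q"
proof -
  obtain A B C D where "P = of_nat p * A + frobenius_poly q * B"
    "Q = of_nat p * C + frobenius_poly q * D"
    using assms by (auto simp: frobenius_ideal_def)
  then have "P + Q = of_nat p * (A + C) + frobenius_poly q * (B + D)"
    by (simp only: distrib_left distrib_right ac_simps)
  then show ?thesis by (rule frobenius_idealI)
qed

lemma frobenius_ideal_mult:
  assumes "P \<in> frobenius_ideal p q"
  shows "Q * P \<in> frobenius_ideal p q"
proof -
  obtain A B where "P = of_nat p * A + frobenius_poly q * B"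
    using assms by (auto simp: frobenius_ideal_def)
  then have "Q * P = of_nat p * (Q * A) + frobenius_poly q * (Q * B)"
    by (simp only: distrib_left mult.left_commute[of Q])
  then show ?thesis by (rule frobenius_idealI)
qed

lemma frobenius_ideal_dvd: "of_nat p dvd P \<Longrightarrow> P \<in> frobenius_ideal p q"
  by (auto elim!: dvdE intro: frobenius_idealI[where B = 0])

lemma frobenius_ideal_Xq: "frobenius_poly q \<in> frobenius_ideal p q"
  by (rule frobenius_idealI[where A = 0 and B = 1]) simp

lemma ideal_frobenius_ideal: "ideal (frobenius_ideal p q) int_poly_ring"
proof (rule idealI)
  interpret Z: cring int_poly_ring by (rule cring_int_poly_ring)
  show "ring int_poly_ring" by (rule Z.ring_axioms)
  show "subgroup (frobenius_ideal p q) (add_monoid int_poly_ring)"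
  proof (rule Z.add.subgroupI)
    fix a assume a: "a \<in> frobenius_ideal p q"
    have "\<ominus>\<^bsub>int_poly_ring\<^esub> a = - a"
      by (rule Z.minus_equality) auto
    moreover have "- a \<in> frobenius_ideal p q" using frobenius_ideal_mult[OF a, of "- 1"] by simp
    ultimately show "\<ominus>\<^bsub>int_poly_ring\<^esub> a \<in> frobenius_ideal p q" by simp
  qed (auto intro: frobenius_ideal_add frobenius_ideal_dvd[of p 0])
qed (use frobenius_ideal_mult in \<open>auto simp: mult.commute\<close>)

text \<open>Additivity of q-th powers modulo p reduces the claim to integer constants, where it is
  Fermat's congruence, and to X, where X^q - X is itself a generator of the ideal.\<close>

lemma frobenius_ideal_power:
  assumes p: "prime p" and q: "q = p ^ k"
  shows "P ^ q - P \<in> frobenius_ideal p q"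
proof (induction P)
  case 0
  have "q > 0" using p q by (simp add: prime_gt_0_nat)
  then show ?case using frobenius_ideal_dvd[of p 0] by (simp add: zero_power)
next
  case (pCons c P)
  define Y :: "int poly" where "Y = [:0, 1:]"
  have eq: "pCons c P = of_int c + Y * P" by (simp add: of_int_poly Y_def)
  have 1: "(of_int c + Y * P) ^ q - (of_int c ^ q + (Y * P) ^ q) \<in> frobenius_ideal p q"
    using frobenius_power_add_dvd[OF p] q by (blast intro: frobenius_ideal_dvd)
  have 2: "of_int c ^ q - of_int c \<in> frobenius_ideal p q"
    using frobenius_power_of_int_dvd[OF p] q by (blast intro: frobenius_ideal_dvd)
  have 3: "Y ^ q * (P ^ q - P) \<in> frobenius_ideal p q"
    using pCons.IH by (rule frobenius_ideal_mult)
  have 4: "P * (Polynomial.monom 1 q - Y) \<in> frobenius_ideal p q"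
    by (rule frobenius_ideal_mult) (simp add: Y_def frobenius_ideal_Xq)
  have Xq: "Polynomial.monom 1 q = Y ^ q" by (simp add: monom_altdef Y_def)
  \<comment> \<open>A telescoping split into the failure of additivity, the Fermat term for c, and
    the two changes that lead from Y^q P^q through Y^q P to Y P.\<close>
  have sum: "(of_int c + Y * P) ^ q - (of_int c + Y * P)
      = ((of_int c + Y * P) ^ q - (of_int c ^ q + (Y * P) ^ q)) + ((of_int c ^ q - of_int c)
        + (Y ^ q * (P ^ q - P) + P * (Polynomial.monom 1 q - Y)))"
    unfolding Xq power_mult_distrib by (simp add: algebra_simps)
  show ?case
    unfolding eq sum by (intro frobenius_ideal_add 1 2 3 4)
qed

text \<open>Reducing the cofactor of p modulo the monic X^q - X makes G - p D a multiple of that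
  polynomial of degree below q, hence zero. Then p would divide the leading coefficient 1.\<close>

lemma monic_notin_frobenius_ideal:
  assumes q: "q \<ge> 2" and p: "prime p"
    and G: "Polynomial.degree G < q" "Polynomial.lead_coeff G = 1"
  shows "G \<notin> frobenius_ideal p q"
proof
  let ?M = "frobenius_poly q"
  assume "G \<in> frobenius_ideal p q"
  then obtain A B where GAB: "G = of_nat p * A + ?M * B" by (auto simp: frobenius_ideal_def)
  obtain C D where A: "A = ?M * C + D" and D: "Polynomial.degree D < q"
    using frobenius_poly_division[OF q] by blast
  have eq: "G - of_nat p * D = ?M * (of_nat p * C + B)"
    by (simp add: GAB A algebra_simps)
  have "of_nat p * D = smult (of_nat p) D" by (simp add: of_nat_poly)
  then have "Polynomial.degree (of_nat p * D) < q" using D degree_smult_le order_le_less_trans by metis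
  then have lt: "Polynomial.degree (G - of_nat p * D) < q" using G by (intro degree_diff_less)
  have "of_nat p * C + B = 0"
  proof (rule ccontr)
    assume "of_nat p * C + B \<noteq> 0"
    moreover have "?M \<noteq> 0" using monic_frobenius_poly(2)[OF q] by (metis Polynomial.coeff_0 zero_neq_one)
    ultimately have "Polynomial.degree (?M * (of_nat p * C + B)) \<ge> q"
      using monic_frobenius_poly(1)[OF q] by (subst degree_mult_eq) auto
    then show False using lt eq by simp
  qed
  then have "G = of_nat p * D" using eq by simp
  then have "G = smult (int p) D" by (simp add: of_nat_poly)
  then have "Polynomial.lead_coeff G = int p * Polynomial.coeff D (Polynomial.degree G)"
    by (metis coeff_smult)
  then have "int p dvd 1" using G by (metis dvd_triv_left)
  then show False using p by (simp add: prime_nat_iff)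
qed

lemma sum_power_less: "p \<ge> 2 \<Longrightarrow> (\<Sum>i\<in>{1..<k}. p ^ i) < (p :: nat) ^ k"
proof (induction k)
  case (Suc k)
  show ?case
  proof (cases "k = 0")
    case False
    then have "{1..<Suc k} = insert k {1..<k}" by auto
    then have "(\<Sum>i\<in>{1..<Suc k}. p ^ i) = p ^ k + (\<Sum>i\<in>{1..<k}. p ^ i)" by simp
    also have "\<dots> < p ^ k + p ^ k" using Suc by simp
    also have "\<dots> \<le> p ^ Suc k" using Suc.prems by (simp flip: mult_2)
    finally show ?thesis .
  qed (use Suc.prems in simp)
qed simp

text \<open>The quotient of \<open>\<int>[X]\<close> by \<open>(p, X\<^sup>q - X)\<close> is a finite reduced ring, and
  \<open>G = \<Prod>\<^sub>i\<^sub><\<^sub>k (X\<^bsup>p^i\<^esup> - X)\<close> is nonzero in it because its degree is too small. In a field factor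
  where \<open>G\<close> survives, the field has at most \<open>q\<close> elements, but not \<open>p\<^sup>i\<close> elements for any \<open>i < k\<close>.\<close>
theorem exists_finite_field:
  assumes p: "prime p" and k: "k > 0"
  shows "\<exists>K :: int poly set ring. field K \<and> finite (carrier K) \<and> card (carrier K) = p ^ k"
proof -
  define q where "q = p ^ k"
  define I where "I = frobenius_ideal p q"
  have p2: "p \<ge> 2" using p by (simp add: prime_ge_2_nat)
  have le_pow: "p ^ i \<ge> 2" if "i > 0" for i
    using p2 that power_increasing[of 1 i p] by simp
  have q2: "q \<ge> 2" using le_pow[OF k] by (simp add: q_def)
  interpret Z: cring int_poly_ring by (rule cring_int_poly_ring)
  interpret I: ideal I int_poly_ring unfolding I_def by (rule ideal_frobenius_ideal)
  define A where "A = int_poly_ring Quot I"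
  interpret A: cring A unfolding A_def by (rule I.quotient_is_cring[OF Z.is_cring])
  define \<pi> where "\<pi> P = I +>\<^bsub>int_poly_ring\<^esub> P" for P
  have \<pi>: "\<pi> \<in> ring_hom int_poly_ring A"
    using I.rcos_ring_hom unfolding A_def \<pi>_def .
  note \<pi>h = ring_hom_memE[OF \<pi>, simplified]
  have \<pi>0: "\<pi> P = \<zero>\<^bsub>A\<^esub> \<longleftrightarrow> P \<in> I" for P
    using I.rcos_const_imp_mem[of P] I.a_rcos_const[of P]
    by (auto simp: \<pi>_def A_def FactRing_def)
  have \<pi>_eq: "\<pi> P = \<pi> Q" if "P - Q \<in> I" for P Q
    using \<pi>h(3)[of "P - Q" Q] that \<pi>0[of "P - Q"] \<pi>h(1) by simp
  have \<pi>_surj: "\<exists>P. a = \<pi> P" if "a \<in> carrier A" for a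
    using that by (auto simp: A_def FactRing_def A_RCOSETS_def' \<pi>_def)
  have Iadd: "P + Q \<in> I" if "P \<in> I" "Q \<in> I" for P Q
    using that frobenius_ideal_add by (simp add: I_def)
  have Imult: "Q * P \<in> I" if "P \<in> I" for P Q
    using that frobenius_ideal_mult by (simp add: I_def)
  have Ipow: "P ^ q - P \<in> I" for P
    unfolding I_def by (rule frobenius_ideal_power[OF p q_def])
  \<comment> \<open>P is the difference of P^q and P^q - P; this is what makes the quotient
    reduced.\<close>
  have Ired: "P \<in> I" if "P ^ q \<in> I" for P
    using Iadd[OF that Imult[OF Ipow[of P], of "- 1"]] by simp
  have A: "reduced_finite A"
  proof (rule reduced_finiteI)
    show "cring A" by (rule A.is_cring)
    define T :: "(nat \<Rightarrow> int) \<Rightarrow> int poly" where "T f = (\<Sum>i<q. Polynomial.monom (f i) i)" for f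
    have cT: "Polynomial.coeff (T f) i = (if i < q then f i else 0)" for f i
      by (simp add: T_def coeff_sum)
    \<comment> \<open>Every class has a representative of degree below q with coefficients in
      {0..<p}.\<close>
    have "carrier A \<subseteq> (\<lambda>f. \<pi> (T f)) ` ({..<q} \<rightarrow>\<^sub>E {0..<int p})"
    proof
      fix a assume "a \<in> carrier A"
      then obtain P where P: "a = \<pi> P" using \<pi>_surj by blast
      obtain C B where CB: "P = frobenius_poly q * C + B" "Polynomial.degree B < q"
        using frobenius_poly_division[OF q2] by blast
      define f where "f = (\<lambda>i\<in>{..<q}. Polynomial.coeff B i mod int p)"
      have "B - T f = smult (int p) (T (\<lambda>i. Polynomial.coeff B i div int p))"
      proof (rule poly_eqI)
        fix i
        show "Polynomial.coeff (B - T f) i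
            = Polynomial.coeff (smult (int p) (T (\<lambda>i. Polynomial.coeff B i div int p))) i"
          using CB(2) by (auto simp: cT f_def coeff_eq_0 minus_mod_eq_mult_div)
      qed
      then have "B = T f + smult (int p) (T (\<lambda>i. Polynomial.coeff B i div int p))"
        by (simp add: algebra_simps)
      then have "P - T f = of_nat p * T (\<lambda>i. Polynomial.coeff B i div int p)
          + frobenius_poly q * C"
        using CB(1) by (simp add: of_nat_poly)
      then have "P - T f \<in> I" unfolding I_def by (rule frobenius_idealI)
      then have "a = \<pi> (T f)" using P \<pi>_eq by simp
      moreover have "f \<in> {..<q} \<rightarrow>\<^sub>E {0..<int p}" using p2 by (auto simp: f_def)
      ultimately show "a \<in> (\<lambda>f. \<pi> (T f)) ` ({..<q} \<rightarrow>\<^sub>E {0..<int p})" by blast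
    qed
    then show "finite (carrier A)"
      by (rule finite_subset) (intro finite_imageI finite_PiE; simp)
    fix a assume a: "a \<in> carrier A" "a \<otimes>\<^bsub>A\<^esub> a = \<zero>\<^bsub>A\<^esub>"
    then obtain P where P: "a = \<pi> P" using \<pi>_surj by blast
    then have "P * P \<in> I" using a \<pi>h(2)[of P P] \<pi>0 by simp
    then have "P ^ (q - 2) * (P * P) \<in> I" by (rule Imult)
    moreover have "P ^ (q - 2) * (P * P) = P ^ q"
      using q2 by (metis power2_eq_square power_add le_add_diff_inverse2)
    ultimately have "P \<in> I" using Ired by simp
    then show "a = \<zero>\<^bsub>A\<^esub>" using P \<pi>0 by simp
  qed
  \<comment> \<open>The index starts at 1, because the factor for i = 0 would be X - X = 0.\<close>
  define G :: "int poly" where "G = (\<Prod>i\<in>{1..<k}. frobenius_poly (p ^ i))"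
  have pi2: "p ^ i \<ge> 2" if "i \<in> {1..<k}" for i
    using that le_pow by simp
  have "G \<notin> I"
    unfolding I_def
  proof (rule monic_notin_frobenius_ideal[OF q2 p])
    have "Polynomial.degree G \<le> (\<Sum>i\<in>{1..<k}. p ^ i)"
      unfolding G_def
      using degree_prod_sum_le[of "{1..<k}" "\<lambda>i. frobenius_poly (p ^ i)"]
        monic_frobenius_poly(1)[OF pi2] by simp
    then show "Polynomial.degree G < q" using sum_power_less[OF p2, of k] by (simp add: q_def)
    show "Polynomial.lead_coeff G = 1"
      unfolding G_def lead_coeff_prod
      using monic_frobenius_poly[OF pi2] by (intro prod.neutral) metis
  qed
  \<comment> \<open>Since every element of A satisfies a^q = a, the power G^(q-1) becomes an
    idempotent u. It acts as the identity on the corner at u, so the image of G is nonzero in each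
    field factor of that corner.\<close>
  define u where "u = \<pi> (G ^ (q - 1))"
  have qS: "q = Suc (q - 1)" "q - 1 > 0" using q2 by simp_all
  have u: "u \<in> carrier A" "u \<otimes>\<^bsub>A\<^esub> u = u" "u \<noteq> \<zero>\<^bsub>A\<^esub>"
  proof -
    show "u \<in> carrier A" unfolding u_def by (rule \<pi>h(1))
    have "G ^ (q - 1) * G ^ (q - 1) - G ^ (q - 1) = G ^ (q - 2) * (G ^ q - G)"
    proof -
      obtain m where "q = 2 + m" using q2 le_Suc_ex by blast
      then show ?thesis by (simp add: algebra_simps)
    qed
    then have "G ^ (q - 1) * G ^ (q - 1) - G ^ (q - 1) \<in> I" using Imult[OF Ipow] by simp
    then show "u \<otimes>\<^bsub>A\<^esub> u = u" unfolding u_def \<pi>h(2)[symmetric] by (rule \<pi>_eq)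
    show "u \<noteq> \<zero>\<^bsub>A\<^esub>"
    proof
      assume "u = \<zero>\<^bsub>A\<^esub>"
      then have "G * G ^ (q - 1) \<in> I" using \<pi>0 Imult by (simp add: u_def)
      then have "G ^ q \<in> I" using qS(1) by (metis power_Suc)
      then show False using Ired \<open>G \<notin> I\<close> by blast
    qed
  qed
  obtain e where e: "e \<in> field_idempotents (corner A u)"
    using reduced_finite_field_idempotent[OF reduced_finite_corner[OF A u(1,2)]] u by auto
  define K where "K = corner (corner A u) e"
  have e': "e \<in> carrier A" "u \<otimes>\<^bsub>A\<^esub> e = e" "e \<otimes>\<^bsub>A\<^esub> e = e" "field K"
    using e by (auto simp: field_idempotents_def K_def)
  interpret K: field K by (rule e'(4))
  have finK: "finite (carrier K)"
    using reduced_finiteD(2)[OF A] by (simp add: K_def)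
  define h where "h P = e \<otimes>\<^bsub>A\<^esub> \<pi> P" for P
  have ee: "e \<otimes>\<^bsub>A\<^esub> (e \<otimes>\<^bsub>A\<^esub> x) = e \<otimes>\<^bsub>A\<^esub> x" "u \<otimes>\<^bsub>A\<^esub> (e \<otimes>\<^bsub>A\<^esub> x) = e \<otimes>\<^bsub>A\<^esub> x" if "x \<in> carrier A" for x
    using that e' u by (simp_all flip: A.m_assoc)
  have h: "h \<in> ring_hom int_poly_ring K"
  proof (rule ring_hom_memI)
    fix P Q
    have "h (P * Q) = e \<otimes>\<^bsub>A\<^esub> e \<otimes>\<^bsub>A\<^esub> (\<pi> P \<otimes>\<^bsub>A\<^esub> \<pi> Q)" by (simp add: h_def \<pi>h e')
    also have "\<dots> = h P \<otimes>\<^bsub>A\<^esub> h Q"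
      using e'(1) \<pi>h(1)[of P] \<pi>h(1)[of Q] unfolding h_def
      by (metis A.m_assoc A.m_comm A.m_closed)
    finally show "h (P \<otimes>\<^bsub>int_poly_ring\<^esub> Q) = h P \<otimes>\<^bsub>K\<^esub> h Q" by (simp add: K_def)
    show "h (P \<oplus>\<^bsub>int_poly_ring\<^esub> Q) = h P \<oplus>\<^bsub>K\<^esub> h Q"
      using e' \<pi>h by (simp add: K_def h_def A.r_distr)
    show "h P \<in> carrier K"
      using e' u \<pi>h(1)[of P] ee by (simp add: K_def h_def)
    show "h \<one>\<^bsub>int_poly_ring\<^esub> = \<one>\<^bsub>K\<^esub>" using e' \<pi>h(4) by (simp add: h_def K_def)
  qed
  define x where "x = h [:0, 1:]"
  have x: "x \<in> carrier K" using ring_hom_memE(1)[OF h] by (simp add: x_def)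
  have hev: "h P = int_eval K x P" for P
    using ring_hom_int_eval[OF cring_int_poly_ring K.is_cring h, of "[:0, 1:]" P]
    by (simp add: int_eval_int_poly_ring x_def)
  have hI: "h P = \<zero>\<^bsub>K\<^esub>" if "P \<in> I" for P
    using that \<pi>0[of P] e' by (simp add: h_def K_def)
  have pow: "a [^]\<^bsub>K\<^esub> q = a" if "a \<in> carrier K" for a
  proof -
    have a: "a \<in> carrier A" "e \<otimes>\<^bsub>A\<^esub> a = a" using that by (simp_all add: K_def)
    then obtain P where P: "a = \<pi> P" using \<pi>_surj by blast
    then have aP: "a = int_eval K x P" using a hev by (simp add: h_def)
    have "int_eval K x (P ^ q - P) = \<zero>\<^bsub>K\<^esub>" using hI[OF Ipow] hev by simp
    then show ?thesis using x that by (simp add: K.int_eval_diff K.int_eval_power aP K.r_right_minus_eq)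
  qed
  \<comment> \<open>All elements satisfy a^q = a, so the nonzero ones are among the at most q - 1
    roots of unity of exponent q - 1.\<close>
  have le: "card (carrier K) \<le> q"
  proof -
    have "carrier K \<subseteq> insert \<zero>\<^bsub>K\<^esub> {a \<in> carrier K. a [^]\<^bsub>K\<^esub> (q - 1) = \<one>\<^bsub>K\<^esub>}"
    proof
      fix a assume a: "a \<in> carrier K"
      have "a [^]\<^bsub>K\<^esub> (q - 1) = \<one>\<^bsub>K\<^esub>" if "a \<noteq> \<zero>\<^bsub>K\<^esub>"
      proof -
        have "a [^]\<^bsub>K\<^esub> (q - 1) \<otimes>\<^bsub>K\<^esub> a = \<one>\<^bsub>K\<^esub> \<otimes>\<^bsub>K\<^esub> a"
          using pow[OF a] a qS(1) by (metis K.l_one K.nat_pow_Suc)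
        then show ?thesis using a that K.m_rcancel K.nat_pow_closed K.one_closed by blast
      qed
      then show "a \<in> insert \<zero>\<^bsub>K\<^esub> {a \<in> carrier K. a [^]\<^bsub>K\<^esub> (q - 1) = \<one>\<^bsub>K\<^esub>}" using a by blast
    qed
    then have "card (carrier K) \<le> card (insert \<zero>\<^bsub>K\<^esub> {a \<in> carrier K. a [^]\<^bsub>K\<^esub> (q - 1) = \<one>\<^bsub>K\<^esub>})"
      using finK by (intro card_mono) auto
    also have "\<dots> \<le> Suc (card {a \<in> carrier K. a [^]\<^bsub>K\<^esub> (q - 1) = \<one>\<^bsub>K\<^esub>})"
      using finK by (simp add: card_insert_if)
    also have "\<dots> \<le> q" using K.num_roots_le_deg[OF finK, of "q - 1"] qS by simp
    finally show ?thesis .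
  qed
  obtain r j where r: "prime r" "j > 0" "card (carrier K) = r ^ j" "int_scalar K (int r) = \<zero>\<^bsub>K\<^esub>"
    using finite_field_card[OF e'(4) finK] by metis
  have "int_scalar K (int p) = \<zero>\<^bsub>K\<^esub>"
    using hI[OF frobenius_ideal_dvd[of p "of_int (int p)" q, folded I_def]] hev K.int_eval_of_int[OF x, of "int p"]
    by simp
  then have "int r dvd int p" using K.int_one_eq_zero_iff[OF r(1,4)] by blast
  then have "r = p" using p r by (simp add: primes_dvd_imp_eq)
  have "j = k"
  proof (rule ccontr)
    assume "j \<noteq> k"
    moreover have "j \<le> k"
      using le r \<open>r = p\<close> p2 by (simp add: q_def)
    ultimately have j: "j \<in> {1..<k}" using r by auto
    have "int_eval K x (frobenius_poly (p ^ j)) = \<zero>\<^bsub>K\<^esub>"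
      using int_eval_frobenius_poly[OF e'(4) finK x] r \<open>r = p\<close> by simp
    then have "int_eval K x G = \<zero>\<^bsub>K\<^esub>"
      unfolding G_def by (intro K.int_eval_prod_eq_zero[OF x _ j]) auto
    then have "h (G ^ (q - 1)) = \<zero>\<^bsub>K\<^esub>"
      using x qS by (simp add: hev K.int_eval_power K.nat_pow_zero)
    moreover have "h (G ^ (q - 1)) = \<one>\<^bsub>K\<^esub>"
      using e' u unfolding h_def u_def[symmetric] by (simp add: K_def A.m_comm)
    ultimately show False by simp
  qed
  then show ?thesis using e'(4) finK r \<open>r = p\<close> by blast
qed

section \<open>Counting ring structures\<close>

definition ext_bij :: "'a set \<Rightarrow> 'b set \<Rightarrow> ('a \<Rightarrow> 'b) set" where
  "ext_bij S T = {f \<in> extensional S. bij_betw f S T}"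

lemma card_ext_bij:
  assumes "finite S" "finite T" "card S = card T"
  shows "card (ext_bij S T) = fact (card S)" "finite (ext_bij S T)"
proof -
  obtain c where c: "bij_betw c S T" using assms finite_same_card_bij by blast
  have "bij_betw (\<lambda>p. restrict (c \<circ> p) S) {p. p permutes S} (ext_bij S T)"
  proof (rule bij_betw_byWitness[where f' = "\<lambda>f x. if x \<in> S then inv_into S c (f x) else x"])
    show "\<forall>p\<in>{p. p permutes S}. (\<lambda>x. if x \<in> S then inv_into S c (restrict (c \<circ> p) S x) else x) = p"
      using c by (auto simp: fun_eq_iff permutes_in_image permutes_not_in bij_betw_inv_into_left)
    show "\<forall>f\<in>ext_bij S T. restrict (c \<circ> (\<lambda>x. if x \<in> S then inv_into S c (f x) else x)) S = f"
    proof
      fix f assume f: "f \<in> ext_bij S T"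
      then have "f x \<in> T" if "x \<in> S" for x using that by (auto simp: ext_bij_def bij_betw_def)
      then show "restrict (c \<circ> (\<lambda>x. if x \<in> S then inv_into S c (f x) else x)) S = f"
        using f c by (intro extensionalityI[of _ S])
          (auto simp: ext_bij_def bij_betw_inv_into_right)
    qed
    show "(\<lambda>p. restrict (c \<circ> p) S) ` {p. p permutes S} \<subseteq> ext_bij S T"
      using c permutes_imp_bij bij_betw_trans
      by (fastforce simp: ext_bij_def cong: bij_betw_cong)
    show "(\<lambda>f x. if x \<in> S then inv_into S c (f x) else x) ` ext_bij S T \<subseteq> {p. p permutes S}"
    proof safe
      fix f assume f: "f \<in> ext_bij S T"
      have "bij_betw (inv_into S c \<circ> f) S S"
        using f bij_betw_inv_into[OF c] bij_betw_trans by (auto simp: ext_bij_def)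
      then have "bij_betw (\<lambda>x. if x \<in> S then inv_into S c (f x) else x) S S"
        by (simp cong: bij_betw_cong)
      then show "(\<lambda>x. if x \<in> S then inv_into S c (f x) else x) permutes S"
        by (rule bij_imp_permutes) simp
    qed
  qed
  then show "card (ext_bij S T) = fact (card S)" "finite (ext_bij S T)"
    using card_permutations[OF refl assms(1)] finite_permutations[OF assms(1)]
    by (auto dest: bij_betw_same_card bij_betw_finite)
qed

text \<open>A structure stores only its two operations, so \<open>SOME\<close> supplies a zero and a
  one that complete them to a reduced finite ring.\<close>

definition species_ring :: "'a set \<Rightarrow> ('a \<Rightarrow> 'a \<Rightarrow> 'a) \<times> ('a \<Rightarrow> 'a \<Rightarrow> 'a) \<Rightarrow> 'a ring" where
  "species_ring S s = (SOME R. \<exists>z\<in>S. \<exists>u\<in>S. R = ring_on S (fst s) (snd s) z u \<and> reduced_finite R)"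

definition pullback_ops ::
    "'a set \<Rightarrow> ('b, 'c) ring_scheme \<Rightarrow> ('a \<Rightarrow> 'b) \<Rightarrow> ('a \<Rightarrow> 'a \<Rightarrow> 'a) \<times> ('a \<Rightarrow> 'a \<Rightarrow> 'a)" where
  "pullback_ops S R f =
     (\<lambda>x\<in>S. \<lambda>y\<in>S. inv_into S f (f x \<oplus>\<^bsub>R\<^esub> f y), \<lambda>x\<in>S. \<lambda>y\<in>S. inv_into S f (f x \<otimes>\<^bsub>R\<^esub> f y))"

lemma ring_on_simps [simp]:
  "carrier (ring_on S a m z u) = S" "x \<oplus>\<^bsub>ring_on S a m z u\<^esub> y = a x y"
  "x \<otimes>\<^bsub>ring_on S a m z u\<^esub> y = m x y" "\<zero>\<^bsub>ring_on S a m z u\<^esub> = z" "\<one>\<^bsub>ring_on S a m z u\<^esub> = u"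
  by (simp_all add: ring_on_def)

lemma
  assumes "s \<in> riemann_species S"
  shows reduced_finite_species_ring: "reduced_finite (species_ring S s)"
    and carrier_species_ring: "carrier (species_ring S s) = S"
    and add_species_ring: "x \<oplus>\<^bsub>species_ring S s\<^esub> y = fst s x y"
    and mult_species_ring: "x \<otimes>\<^bsub>species_ring S s\<^esub> y = snd s x y"
proof -
  obtain z u where "z \<in> S" "u \<in> S" "reduced_finite (ring_on S (fst s) (snd s) z u)"
    using assms by (auto simp: riemann_species_def semisimple_finite_cring_iff)
  then have "\<exists>R. \<exists>z\<in>S. \<exists>u\<in>S. R = ring_on S (fst s) (snd s) z u \<and> reduced_finite R"
    by blast
  then have "\<exists>z\<in>S. \<exists>u\<in>S. species_ring S s = ring_on S (fst s) (snd s) z u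
      \<and> reduced_finite (species_ring S s)"
    unfolding species_ring_def by (rule someI_ex)
  then obtain z u where "species_ring S s = ring_on S (fst s) (snd s) z u"
    and red: "reduced_finite (species_ring S s)"
    by blast
  then show "carrier (species_ring S s) = S" "x \<oplus>\<^bsub>species_ring S s\<^esub> y = fst s x y"
    "x \<otimes>\<^bsub>species_ring S s\<^esub> y = snd s x y" "reduced_finite (species_ring S s)"
    by simp_all
qed

lemma pullback_ops_in_species:
  assumes R: "reduced_finite R" and f: "bij_betw f S (carrier R)"
  shows "pullback_ops S R f \<in> riemann_species S"
proof -
  interpret R: cring R using R by (rule reduced_finiteD)
  define g where "g = inv_into S f"
  have gf: "g (f x) = x" if "x \<in> S" for x
    using that f by (simp add: g_def bij_betw_inv_into_left)
  have fg: "f (g y) = y" if "y \<in> carrier R" for y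
    using that f by (simp add: g_def bij_betw_inv_into_right)
  have g: "bij_betw g (carrier R) S" unfolding g_def using f by (rule bij_betw_inv_into)
  have gS: "g y \<in> S" if "y \<in> carrier R" for y using bij_betwE[OF g] that by blast
  have fR: "f x \<in> carrier R" if "x \<in> S" for x using bij_betwE[OF f] that by blast
  obtain a m where am: "pullback_ops S R f = (a, m)" by fastforce
  then have a: "a = (\<lambda>x\<in>S. \<lambda>y\<in>S. g (f x \<oplus>\<^bsub>R\<^esub> f y))" and m: "m = (\<lambda>x\<in>S. \<lambda>y\<in>S. g (f x \<otimes>\<^bsub>R\<^esub> f y))"
    by (auto simp: pullback_ops_def g_def)
  define T where "T = ring_on S a m (g \<zero>\<^bsub>R\<^esub>) (g \<one>\<^bsub>R\<^esub>)"
  have iso: "g \<in> ring_iso R T"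
    using g gS by (intro ring_iso_memI) (simp_all add: T_def a m fg)
  have "cring (T\<lparr>zero := g \<zero>\<^bsub>R\<^esub>\<rparr>)" using iso by (rule R.ring_iso_imp_img_cring)
  then have T: "cring T" by (simp add: T_def ring_on_def)
  have "reduced_finite T"
    using reduced_finite_iso[OF T R ring_iso_set_sym[OF R.ring_axioms iso]] .
  moreover have "a \<in> S \<rightarrow>\<^sub>E S \<rightarrow>\<^sub>E S" "m \<in> S \<rightarrow>\<^sub>E S \<rightarrow>\<^sub>E S"
    using fR gS by (auto simp: a m)
  ultimately show ?thesis
    using gS[OF R.zero_closed] gS[OF R.one_closed]
    by (auto simp: am riemann_species_def semisimple_finite_cring_iff T_def)
qed

lemma pullback_ops_iso:
  assumes R: "reduced_finite R" and f: "bij_betw f S (carrier R)"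
  shows "f \<in> ring_iso (species_ring S (pullback_ops S R f)) R"
proof -
  let ?T = "species_ring S (pullback_ops S R f)"
  interpret R: cring R using R by (rule reduced_finiteD)
  note sp = pullback_ops_in_species[OF R f]
  have fR: "f x \<in> carrier R" if "x \<in> S" for x using bij_betwE[OF f] that by blast
  show ?thesis
  proof (rule ring_iso_memI_cring)
    show "cring ?T" using reduced_finite_species_ring[OF sp] by (rule reduced_finiteD)
    show "cring R" by (rule R.is_cring)
    show "bij_betw f (carrier ?T) (carrier R)" using f by (simp add: carrier_species_ring[OF sp])
    fix x y assume "x \<in> carrier ?T" "y \<in> carrier ?T"
    then have xy: "x \<in> S" "y \<in> S" by (simp_all add: carrier_species_ring[OF sp])
    show "f (x \<otimes>\<^bsub>?T\<^esub> y) = f x \<otimes>\<^bsub>R\<^esub> f y"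
      using xy fR f unfolding mult_species_ring[OF sp]
      by (simp add: pullback_ops_def bij_betw_inv_into_right)
    show "f (x \<oplus>\<^bsub>?T\<^esub> y) = f x \<oplus>\<^bsub>R\<^esub> f y"
      using xy fR f unfolding add_species_ring[OF sp]
      by (simp add: pullback_ops_def bij_betw_inv_into_right)
  qed
qed

text \<open>Extensionality of the stored operations upgrades agreement on S to equality of
  functions. Together with \<open>pullback_ops_iso\<close>, for reduced finite R, the bijections
  that induce s are exactly the isomorphisms from s onto R; this identifies the fibres in the double
  count.\<close>

lemma pullback_ops_eq:
  assumes s: "s \<in> riemann_species S" and f: "f \<in> ring_iso (species_ring S s) R"
  shows "pullback_ops S R f = s"
proof -
  note car = carrier_species_ring[OF s]
  interpret T: cring "species_ring S s"
    using reduced_finite_species_ring[OF s] by (rule reduced_finiteD)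
  note ff = ring_iso_memE[OF f, unfolded car]
  have s': "fst s \<in> S \<rightarrow>\<^sub>E S \<rightarrow>\<^sub>E S" "snd s \<in> S \<rightarrow>\<^sub>E S \<rightarrow>\<^sub>E S"
    using s unfolding riemann_species_def mem_Collect_eq case_prod_beta by blast+
  have ext: "(\<lambda>x\<in>S. \<lambda>y\<in>S. b x y) = b'"
    if "b' \<in> S \<rightarrow>\<^sub>E S \<rightarrow>\<^sub>E S" "\<And>x y. x \<in> S \<Longrightarrow> y \<in> S \<Longrightarrow> b x y = b' x y"
    for b b' :: "'a \<Rightarrow> 'a \<Rightarrow> 'a"
  proof -
    have "(\<lambda>y\<in>S. b x y) = b' x" if x: "x \<in> S" for x
      using PiE_mem[OF \<open>b' \<in> _\<close> x] \<open>\<And>x y. x \<in> S \<Longrightarrow> y \<in> S \<Longrightarrow> b x y = b' x y\<close> x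
      by (intro extensionalityI[of _ S]) (auto simp: PiE_def)
    then show ?thesis
      using \<open>b' \<in> _\<close> by (intro extensionalityI[of _ S]) (auto simp: PiE_def)
  qed
  have "inv_into S f (f x \<oplus>\<^bsub>R\<^esub> f y) = fst s x y" "inv_into S f (f x \<otimes>\<^bsub>R\<^esub> f y) = snd s x y"
    if xy: "x \<in> S" "y \<in> S" for x y
  proof -
    have "inv_into S f (f (x \<oplus>\<^bsub>species_ring S s\<^esub> y)) = x \<oplus>\<^bsub>species_ring S s\<^esub> y"
      using xy car T.a_closed[of x y] by (intro bij_betw_inv_into_left[OF ff(5)]) simp
    then show "inv_into S f (f x \<oplus>\<^bsub>R\<^esub> f y) = fst s x y"
      using ff(3)[OF xy] add_species_ring[OF s] by simp
    have "inv_into S f (f (x \<otimes>\<^bsub>species_ring S s\<^esub> y)) = x \<otimes>\<^bsub>species_ring S s\<^esub> y"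
      using xy car T.m_closed[of x y] by (intro bij_betw_inv_into_left[OF ff(5)]) simp
    then show "inv_into S f (f x \<otimes>\<^bsub>R\<^esub> f y) = snd s x y"
      using ff(2)[OF xy] mult_species_ring[OF s] by simp
  qed
  then show ?thesis
    unfolding pullback_ops_def by (simp add: prod_eq_iff ext[OF s'(1)] ext[OF s'(2)])
qed

section \<open>Splitting off a distinguished field factor\<close>

lemma field_iso:
  assumes "field K" "ring R" "f \<in> ring_iso R K"
  shows "field R"
proof -
  interpret K: field K by fact
  interpret R: ring R by fact
  let ?g = "inv_into (carrier R) f"
  have g: "?g \<in> ring_iso K R" using ring_iso_set_sym assms(2,3) by blast
  have "field (R\<lparr>zero := ?g \<zero>\<^bsub>K\<^esub>\<rparr>)" using g by (rule K.ring_iso_imp_img_field)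
  then show ?thesis using ring_iso_zero[OF K.ring_axioms R.ring_axioms g] by simp
qed

text \<open>Under f, multiplication by e becomes (a, c) |-> (a, 0), so the corner is the preimage of
  A x {0}.\<close>

lemma corner_iso_fst:
  assumes R: "cring R" and A: "cring A" and C: "cring C" and f: "f \<in> ring_iso R (RDirProd A C)"
    and e: "e \<in> carrier R" "f e = (\<one>\<^bsub>A\<^esub>, \<zero>\<^bsub>C\<^esub>)"
  shows "e \<otimes>\<^bsub>R\<^esub> e = e" "(\<lambda>x. fst (f x)) \<in> ring_iso (corner R e) A"
proof -
  interpret R: cring R by fact
  interpret A: cring A by fact
  interpret C: cring C by fact
  note ff = ring_iso_memE[OF f]
  have inj: "x = y" if "x \<in> carrier R" "y \<in> carrier R" "f x = f y" for x y
    using inj_onD[OF bij_betw_imp_inj_on[OF ff(5)]] that by blast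
  have fcl: "fst (f x) \<in> carrier A" "snd (f x) \<in> carrier C" if "x \<in> carrier R" for x
    using ff(1)[OF that] by auto
  have fe: "f (e \<otimes>\<^bsub>R\<^esub> x) = (fst (f x), \<zero>\<^bsub>C\<^esub>)" if "x \<in> carrier R" for x
    using ff(2)[OF e(1) that] fcl[OF that] e(2) by simp
  show ee: "e \<otimes>\<^bsub>R\<^esub> e = e" using fe[OF e(1)] e by (intro inj) simp_all
  have fx: "f x = (fst (f x), \<zero>\<^bsub>C\<^esub>)" if "x \<in> carrier R" "e \<otimes>\<^bsub>R\<^esub> x = x" for x
    using fe[OF that(1)] that(2) by simp
  show "(\<lambda>x. fst (f x)) \<in> ring_iso (corner R e) A"
  proof (rule ring_iso_memI_cring)
    show "cring (corner R e)" using R.corner_cring e(1) ee .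
    show "cring A" by fact
    show "bij_betw (\<lambda>x. fst (f x)) (carrier (corner R e)) (carrier A)"
    proof (rule bij_betwI')
      fix x y assume "x \<in> carrier (corner R e)" "y \<in> carrier (corner R e)"
      then have xy: "x \<in> carrier R" "y \<in> carrier R" "e \<otimes>\<^bsub>R\<^esub> x = x" "e \<otimes>\<^bsub>R\<^esub> y = y" by auto
      show "(fst (f x) = fst (f y)) = (x = y)"
        using fx[OF xy(1,3)] fx[OF xy(2,4)] inj[OF xy(1,2)] by metis
    next
      fix x assume "x \<in> carrier (corner R e)"
      then show "fst (f x) \<in> carrier A" using fcl by simp
    next
      fix a assume a: "a \<in> carrier A"
      then have "(a, \<zero>\<^bsub>C\<^esub>) \<in> f ` carrier R"
        using bij_betw_imp_surj_on[OF ff(5)] by simp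
      then obtain x where x: "x \<in> carrier R" "f x = (a, \<zero>\<^bsub>C\<^esub>)" by (metis imageE)
      have "e \<otimes>\<^bsub>R\<^esub> x = x" using fe[OF x(1)] x e by (intro inj) simp_all
      then show "\<exists>x\<in>carrier (corner R e). a = fst (f x)" using x by (intro bexI[of _ x]) auto
    qed
  qed (use ff(2,3) in simp_all)
qed

text \<open>Swapping the factors reduces this to \<open>corner_iso_fst\<close> for 1 - e, which f
  sends to (0, 1) because it sums with e to 1 and multiplies with e to 0.\<close>

lemma corner_iso_snd:
  assumes R: "cring R" and A: "cring A" and C: "cring C" and f: "f \<in> ring_iso R (RDirProd A C)"
    and e: "e \<in> carrier R" "f e = (\<one>\<^bsub>A\<^esub>, \<zero>\<^bsub>C\<^esub>)"
  shows "(\<lambda>x. snd (f x)) \<in> ring_iso (corner R (\<one>\<^bsub>R\<^esub> \<ominus>\<^bsub>R\<^esub> e)) C"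
proof -
  interpret R: cring R by fact
  interpret A: cring A by fact
  interpret C: cring C by fact
  note ff = ring_iso_memE[OF f]
  let ?g = "(\<lambda>(x, y). (y, x)) \<circ> f"
  have g: "?g \<in> ring_iso R (RDirProd C A)" using ring_iso_set_trans[OF f RDirProd_iso1] .
  let ?d = "\<one>\<^bsub>R\<^esub> \<ominus>\<^bsub>R\<^esub> e"
  have d: "?d \<in> carrier R" using e by simp
  have ee: "e \<otimes>\<^bsub>R\<^esub> e = e" by (rule corner_iso_fst[OF R A C f e])
  have cl: "fst (f ?d) \<in> carrier A" "snd (f ?d) \<in> carrier C" using ff(1)[OF d] by auto
  have "f e \<oplus>\<^bsub>RDirProd A C\<^esub> f ?d = \<one>\<^bsub>RDirProd A C\<^esub>"
    using ff(3)[OF e(1) d] ff(4) R.complement_idem(3)[OF e(1) ee] by simp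
  then have 1: "snd (f ?d) = \<one>\<^bsub>C\<^esub>" using e cl by simp
  have "f e \<otimes>\<^bsub>RDirProd A C\<^esub> f ?d = \<zero>\<^bsub>RDirProd A C\<^esub>"
    using ff(2)[OF e(1) d] R.complement_idem(2)[OF e(1) ee]
      ring_iso_zero[OF R.ring_axioms RDirProd_ring[OF A.ring_axioms C.ring_axioms] f] by simp
  then have 2: "fst (f ?d) = \<zero>\<^bsub>A\<^esub>" using e cl by simp
  have "?g ?d = (\<one>\<^bsub>C\<^esub>, \<zero>\<^bsub>A\<^esub>)" using 1 2 by (simp add: case_prod_beta)
  from corner_iso_fst(2)[OF R C A g d this] show ?thesis
    by (simp add: case_prod_beta)
qed

text \<open>Double counting of the pairs \<open>(\<phi>, r)\<close> of a bijection \<open>\<phi>\<close> from \<open>S\<close> to \<open>K \<times> {0..<m}\<close> and a ring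
  structure \<open>r\<close> on \<open>{0..<m}\<close>: such a pair induces a ring structure on \<open>S\<close> with a distinguished
  factor \<open>K\<close>, and a given structure with distinguished field factor \<open>e\<close> arises once for each
  isomorphism of the \<open>e\<close>-corner with \<open>K\<close> and each bijection of the complementary corner with
  \<open>{0..<m}\<close>.\<close>
lemma card_species_with_field_factor:
  fixes S :: "'a set" and K :: "('k, 'l) ring_scheme"
  assumes S: "finite S" "card S = p ^ k * m"
    and K: "field K" "finite (carrier K)" "card (carrier K) = p ^ k" and p: "prime p" "k > 0"
    and B: "card (riemann_species {0..<m}) = fact m"
  shows "k * card {(s, e). s \<in> riemann_species S \<and> e \<in> field_idempotents (species_ring S s) \<and>
      card (carrier (corner (species_ring S s) e)) = p ^ k} = fact (card S)"
proof -
  interpret K: field K by fact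
  define B where "B = {0..<m}"
  define Q where "Q = {(s, e). s \<in> riemann_species S \<and> e \<in> field_idempotents (species_ring S s) \<and>
      card (carrier (corner (species_ring S s) e)) = p ^ k}"
  define Y where "Y = ext_bij S (carrier K \<times> B) \<times> riemann_species B"
  define T where "T r = RDirProd K (species_ring B r)" for r
  \<comment> \<open>The distinguished idempotent is the preimage of (1, 0), the identity of the
    factor K.\<close>
  define \<Psi> where "\<Psi> = (\<lambda>(\<phi>, r). (pullback_ops S (T r) \<phi>,
    inv_into S \<phi> (\<one>\<^bsub>K\<^esub>, \<zero>\<^bsub>species_ring B r\<^esub>)))"
  have redT: "reduced_finite (T r)" and carT: "carrier (T r) = carrier K \<times> B"
    and cringB: "cring (species_ring B r)" if "r \<in> riemann_species B" for r
    using reduced_finite_RDirProd[OF field_imp_reduced_finite[OF K(1,2)]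
        reduced_finite_species_ring[OF that]] carrier_species_ring[OF that]
      reduced_finiteD(1)[OF reduced_finite_species_ring[OF that]]
    by (simp_all add: T_def)
  have cringS: "cring (species_ring S s)" if "s \<in> riemann_species S" for s
    using reduced_finiteD(1)[OF reduced_finite_species_ring[OF that]] .

  have finB: "finite (riemann_species B)"
    using B card_ge_0_finite[of "riemann_species B"] by (simp add: B_def)
  have cY: "card Y = fact (card S) * fact m" and finY: "finite Y"
  proof -
    have "card S = card (carrier K \<times> B)" "finite (carrier K \<times> B)"
      using S K by (simp_all add: B_def card_cartesian_product)
    from card_ext_bij[OF S(1) this(2,1)] show "card Y = fact (card S) * fact m" "finite Y"
      using B finB by (simp_all add: Y_def B_def card_cartesian_product)
  qed

  have \<Psi>_iso: "s \<in> riemann_species S" "e \<in> S" "\<phi> \<in> ring_iso (species_ring S s) (T r)"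
      "\<phi> e = (\<one>\<^bsub>K\<^esub>, \<zero>\<^bsub>species_ring B r\<^esub>)"
    if y: "(\<phi>, r) \<in> Y" "\<Psi> (\<phi>, r) = (s, e)" for \<phi> r s e
  proof -
    have r: "r \<in> riemann_species B" and \<phi>: "bij_betw \<phi> S (carrier (T r))"
      using y(1) carT by (auto simp: Y_def ext_bij_def)
    have se: "s = pullback_ops S (T r) \<phi>" "e = inv_into S \<phi> (\<one>\<^bsub>K\<^esub>, \<zero>\<^bsub>species_ring B r\<^esub>)"
      using y(2) by (simp_all add: \<Psi>_def)
    interpret C: cring "species_ring B r" using cringB[OF r] .
    show "s \<in> riemann_species S" unfolding se by (rule pullback_ops_in_species[OF redT[OF r] \<phi>])
    show "\<phi> \<in> ring_iso (species_ring S s) (T r)"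
      unfolding se by (rule pullback_ops_iso[OF redT[OF r] \<phi>])
    have mem: "(\<one>\<^bsub>K\<^esub>, \<zero>\<^bsub>species_ring B r\<^esub>) \<in> carrier (T r)" by (simp add: T_def)
    show "\<phi> e = (\<one>\<^bsub>K\<^esub>, \<zero>\<^bsub>species_ring B r\<^esub>)"
      unfolding se by (rule bij_betw_inv_into_right[OF \<phi> mem])
    show "e \<in> S"
      unfolding se using bij_betwE[OF bij_betw_inv_into[OF \<phi>]] mem by blast
  qed

  have \<Psi>Q: "\<Psi> ` Y \<subseteq> Q"
  proof (rule image_subsetI)
    fix y assume y: "y \<in> Y"
    obtain \<phi> r where yr: "y = (\<phi>, r)" by (cases y)
    obtain s e where se: "\<Psi> y = (s, e)" by (cases "\<Psi> y")
    note iso = \<Psi>_iso[OF y[unfolded yr] se[unfolded yr]]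
    have r: "r \<in> riemann_species B" using y by (simp add: yr Y_def)
    let ?R = "species_ring S s"
    have e: "e \<in> carrier ?R" using iso(2) carrier_species_ring[OF iso(1)] by simp
    note fst = corner_iso_fst[OF cringS[OF iso(1)] K.is_cring cringB[OF r] iso(3)[unfolded T_def] e iso(4)]
    have "field (corner ?R e)"
      using field_iso[OF K(1) cring.axioms(1)[OF cring.corner_cring[OF cringS[OF iso(1)] e fst(1)]] fst(2)] .
    moreover have "card (carrier (corner ?R e)) = p ^ k"
      using bij_betw_same_card[OF ring_iso_memE(5)[OF fst(2)]] K(3) by simp
    ultimately show "\<Psi> y \<in> Q"
      using iso(1) e fst(1) by (simp add: se Q_def field_idempotents_def)
  qed

  have fiber: "card {y \<in> Y. \<Psi> y = x} = k * fact m" if x: "x \<in> Q" for x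
  proof -
    obtain s e where se: "x = (s, e)" by (cases x)
    define R where "R = species_ring S s"
    have s: "s \<in> riemann_species S" and efi: "e \<in> field_idempotents R"
      and cE: "card (carrier (corner R e)) = p ^ k"
      using x by (simp_all add: se Q_def R_def)
    have e: "e \<in> carrier R" "e \<otimes>\<^bsub>R\<^esub> e = e" "field (corner R e)"
      using efi by (auto simp: field_idempotents_def)
    have R: "reduced_finite R" using reduced_finite_species_ring[OF s] by (simp add: R_def)
    interpret R: cring R using R by (rule reduced_finiteD)
    have carR: "carrier R = S" using carrier_species_ring[OF s] by (simp add: R_def)
    define d where "d = \<one>\<^bsub>R\<^esub> \<ominus>\<^bsub>R\<^esub> e"
    have d: "d \<in> carrier R" "d \<otimes>\<^bsub>R\<^esub> d = d" "d \<otimes>\<^bsub>R\<^esub> e = \<zero>\<^bsub>R\<^esub>"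
      using R.complement_idem[OF e(1,2)] e(1) R.m_comm[of d e] by (simp_all add: d_def)
    define C where "C = carrier (corner R d)"
    define E where "E = carrier (corner R e)"
    have CS: "C \<subseteq> S" and ES: "E \<subseteq> S" by (auto simp: C_def E_def carR)
    have finC: "finite C" "finite E" using S CS ES finite_subset by blast+
    have redC: "reduced_finite (corner R d)" using reduced_finite_corner[OF R d(1,2)] .
    interpret C: cring "corner R d" using redC by (rule reduced_finiteD)
    interpret E: field "corner R e" by (rule e(3))
    have "p ^ k * m = p ^ k * card C"
      using reduced_finite_card_split[OF R e(1,2)] S carR cE by (simp add: C_def d_def)
    then have cC: "card C = m" using p by (simp add: prime_gt_0_nat)
    define I where "I = (ring_iso (corner R e) K \<inter> extensional E) \<times> ext_bij C B"
    \<comment> \<open>Here h is a mere bijection. Equipping B with the structure transported from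
      the complementary corner turns h into an isomorphism.\<close>
    define \<Theta> where "\<Theta> = (\<lambda>(g :: 'a \<Rightarrow> 'k, h :: 'a \<Rightarrow> nat). (\<lambda>x\<in>S. (g (e \<otimes>\<^bsub>R\<^esub> x), h (d \<otimes>\<^bsub>R\<^esub> x)),
      pullback_ops B (corner R d) (inv_into C h)))"
    define \<Theta>' where "\<Theta>' = (\<lambda>(\<phi>, r :: (nat \<Rightarrow> nat \<Rightarrow> nat) \<times> (nat \<Rightarrow> nat \<Rightarrow> nat)).
      (\<lambda>x\<in>E. fst (\<phi> x) :: 'k, \<lambda>x\<in>C. snd (\<phi> x) :: nat))"
    have eE: "e \<otimes>\<^bsub>R\<^esub> x \<in> E" if "x \<in> S" for x
      using that e R.m_closed[of e x] by (simp add: E_def carR R.m_assoc[symmetric])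
    have dC: "d \<otimes>\<^bsub>R\<^esub> x \<in> C" if "x \<in> S" for x
      using that d R.m_closed[of d x] by (simp add: C_def carR R.m_assoc[symmetric])
    have Efix: "e \<otimes>\<^bsub>R\<^esub> x = x" if "x \<in> E" for x using that by (simp add: E_def)
    have Cfix: "d \<otimes>\<^bsub>R\<^esub> x = x" if "x \<in> C" for x using that by (simp add: C_def)

    have h_iso: "pullback_ops B (corner R d) (inv_into C h) \<in> riemann_species B"
      "h \<in> ring_iso (corner R d) (species_ring B (pullback_ops B (corner R d) (inv_into C h)))"
      if h: "h \<in> ext_bij C B" for h
    proof -
      let ?i = "inv_into C h" let ?r = "pullback_ops B (corner R d) ?i"
      have hb: "bij_betw h C B" using h by (simp add: ext_bij_def)
      have i: "bij_betw ?i B (carrier (corner R d))"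
        using bij_betw_inv_into[OF hb] by (simp only: C_def)
      show r: "?r \<in> riemann_species B" by (rule pullback_ops_in_species[OF redC i])
      have "?i \<in> ring_iso (species_ring B ?r) (corner R d)" by (rule pullback_ops_iso[OF redC i])
      from ring_iso_set_sym[OF cring.axioms(1)[OF cringB[OF r]] this]
      have "inv_into B ?i \<in> ring_iso (corner R d) (species_ring B ?r)"
        using carrier_species_ring[OF r] by simp
      then show "h \<in> ring_iso (corner R d) (species_ring B ?r)"
        \<comment> \<open>Inverting \<open>inv_into C h\<close> again gives a function that agrees
          with h on C, though possibly not elsewhere.\<close>
        by (rule C.ring_iso_restrict) (metis C_def hb inv_into_inv_into_eq)
    qed

    have "bij_betw \<Theta> I {y \<in> Y. \<Psi> y = x}"
    proof (rule bij_betw_byWitness[where f' = \<Theta>'])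
      show "\<forall>gh\<in>I. \<Theta>' (\<Theta> gh) = gh"
      proof safe
        fix g h assume gh: "(g, h) \<in> I"
        have "(\<lambda>x\<in>E. fst ((\<lambda>x\<in>S. (g (e \<otimes>\<^bsub>R\<^esub> x), h (d \<otimes>\<^bsub>R\<^esub> x))) x)) = g"
          using gh ES Efix by (intro extensionalityI[of _ E]) (auto simp: I_def)
        moreover have "(\<lambda>x\<in>C. snd ((\<lambda>x\<in>S. (g (e \<otimes>\<^bsub>R\<^esub> x), h (d \<otimes>\<^bsub>R\<^esub> x))) x)) = h"
          using gh CS Cfix by (intro extensionalityI[of _ C]) (auto simp: I_def ext_bij_def)
        ultimately show "\<Theta>' (\<Theta> (g, h)) = (g, h)" by (simp add: \<Theta>_def \<Theta>'_def)
      qed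
    next
      show "\<Theta> ` I \<subseteq> {y \<in> Y. \<Psi> y = x}"
      proof (rule image_subsetI)
        fix gh assume "gh \<in> I"
        moreover obtain g h where gh: "gh = (g, h)" by (cases gh)
        ultimately have g: "g \<in> ring_iso (corner R e) K" and h: "h \<in> ext_bij C B"
          by (auto simp: I_def)
        let ?r = "pullback_ops B (corner R d) (inv_into C h)"
        let ?\<phi> = "\<lambda>x\<in>S. (g (e \<otimes>\<^bsub>R\<^esub> x), h (d \<otimes>\<^bsub>R\<^esub> x))"
        note r = h_iso(1)[OF h] and hi = h_iso(2)[OF h]
        have "(\<lambda>(a, b). (g a, h b)) \<circ> (\<lambda>x. (e \<otimes>\<^bsub>R\<^esub> x, d \<otimes>\<^bsub>R\<^esub> x)) \<in> ring_iso R (T ?r)"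
          unfolding T_def d_def
          using ring_iso_set_trans[OF R.corner_decomposition[OF e(1,2)] RDirProd_iso6[OF g hi[unfolded d_def]]]
          by (simp add: d_def)
        then have \<phi>: "?\<phi> \<in> ring_iso R (T ?r)"
          by (rule R.ring_iso_restrict) (simp add: carR)
        then have \<phi>b: "bij_betw ?\<phi> S (carrier (T ?r))"
          using ring_iso_memE(5) carR by metis
        have Y: "(?\<phi>, ?r) \<in> Y"
          using \<phi>b r carT[OF r] by (simp add: Y_def ext_bij_def)
        have "g (e \<otimes>\<^bsub>R\<^esub> e) = \<one>\<^bsub>K\<^esub>" using ring_iso_memE(4)[OF g] e by simp
        moreover have "h (d \<otimes>\<^bsub>R\<^esub> e) = \<zero>\<^bsub>species_ring B ?r\<^esub>"
          using ring_iso_zero[OF C.ring_axioms cring.axioms(1)[OF cringB[OF r]] hi] d by simp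
        ultimately have "?\<phi> e = (\<one>\<^bsub>K\<^esub>, \<zero>\<^bsub>species_ring B ?r\<^esub>)" using e carR by simp
        then have "inv_into S ?\<phi> (\<one>\<^bsub>K\<^esub>, \<zero>\<^bsub>species_ring B ?r\<^esub>) = e"
          using bij_betw_inv_into_left[OF \<phi>b, of e] e carR by simp
        moreover have "pullback_ops S (T ?r) ?\<phi> = s"
          using pullback_ops_eq[OF s \<phi>[unfolded R_def]] by (simp add: R_def)
        ultimately have "\<Psi> (?\<phi>, ?r) = x" by (simp add: \<Psi>_def se)
        then show "\<Theta> gh \<in> {y \<in> Y. \<Psi> y = x}"
          using Y by (simp add: gh \<Theta>_def)
      qed
    next
      \<comment> \<open>A pair in the fibre makes \<phi> an isomorphism from R to the product of K
        with r, taking e to (1, 0). It therefore restricts to isomorphisms of the two corners, and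
        the second of these recovers r.\<close>
      have key: "\<Theta>' (\<phi>, r) \<in> I \<and> \<Theta> (\<Theta>' (\<phi>, r)) = (\<phi>, r)"
        if y: "(\<phi>, r) \<in> Y" "\<Psi> (\<phi>, r) = x" for \<phi> r
      proof -
        have r: "r \<in> riemann_species B" and ext: "\<phi> \<in> extensional S"
          using y by (auto simp: Y_def ext_bij_def)
        interpret D: cring "species_ring B r" using cringB[OF r] .
        note iso = \<Psi>_iso[OF y(1) y(2)[unfolded se]]
        have \<phi>: "\<phi> \<in> ring_iso R (RDirProd K (species_ring B r))"
          using iso(3) by (simp add: R_def T_def)
        let ?g = "\<lambda>x\<in>E. fst (\<phi> x)" let ?h = "\<lambda>x\<in>C. snd (\<phi> x)"
        have "(\<lambda>x. fst (\<phi> x)) \<in> ring_iso (corner R e) K"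
          using corner_iso_fst(2)[OF R.is_cring K.is_cring D.is_cring \<phi> e(1) iso(4)] .
        then have g: "?g \<in> ring_iso (corner R e) K"
          by (rule E.ring_iso_restrict) (simp add: E_def)
        have "(\<lambda>x. snd (\<phi> x)) \<in> ring_iso (corner R d) (species_ring B r)"
          using corner_iso_snd[OF R.is_cring K.is_cring D.is_cring \<phi> e(1) iso(4)] by (simp add: d_def)
        then have h: "?h \<in> ring_iso (corner R d) (species_ring B r)"
          by (rule C.ring_iso_restrict) (simp add: C_def)
        have hb: "bij_betw ?h C B"
          using ring_iso_memE(5)[OF h] by (simp only: carrier_species_ring[OF r] C_def)
        have "inv_into C ?h \<in> ring_iso (species_ring B r) (corner R d)"
          using ring_iso_set_sym[OF C.ring_axioms h] by (simp only: C_def)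
        then have pr: "pullback_ops B (corner R d) (inv_into C ?h) = r"
          by (rule pullback_ops_eq[OF r])
        have "(\<lambda>x\<in>S. (?g (e \<otimes>\<^bsub>R\<^esub> x), ?h (d \<otimes>\<^bsub>R\<^esub> x))) = \<phi>"
        proof (rule extensionalityI[of _ S])
          fix x assume x: "x \<in> S"
          note pp = ring_iso_memE[OF \<phi>, unfolded carR]
          have cl: "fst (\<phi> x) \<in> carrier K" "snd (\<phi> x) \<in> carrier (species_ring B r)"
            using pp(1)[OF x] by auto
          have "\<phi> (e \<otimes>\<^bsub>R\<^esub> x) = (fst (\<phi> x), \<zero>\<^bsub>species_ring B r\<^esub>)"
            using pp(2)[OF _ x, of e] e(1) carR iso(4) cl by simp
          moreover have "\<phi> d = (\<zero>\<^bsub>K\<^esub>, \<one>\<^bsub>species_ring B r\<^esub>)"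
          proof -
            have dS: "d \<in> S" "e \<in> S" using d e carR by auto
            have "fst (\<phi> d) \<in> carrier K" "snd (\<phi> d) \<in> carrier (species_ring B r)"
              using pp(1)[OF dS(1)] by auto
            moreover have "\<phi> (e \<oplus>\<^bsub>R\<^esub> d) = \<one>\<^bsub>RDirProd K (species_ring B r)\<^esub>"
              using R.complement_idem(3)[OF e(1,2)] pp(4) by (simp add: d_def)
            moreover have "\<phi> (d \<otimes>\<^bsub>R\<^esub> e) = \<zero>\<^bsub>RDirProd K (species_ring B r)\<^esub>"
              using ring_iso_zero[OF R.ring_axioms RDirProd_ring[OF K.ring_axioms D.ring_axioms] \<phi>] d(3)
              by simp
            ultimately show ?thesis
              using pp(2)[OF dS] pp(3)[OF dS(2,1)] iso(4) by (simp add: prod_eq_iff)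
          qed
          then have "\<phi> (d \<otimes>\<^bsub>R\<^esub> x) = (\<zero>\<^bsub>K\<^esub>, snd (\<phi> x))"
            using pp(2)[OF _ x, of d] d(1) carR cl by simp
          ultimately show "(\<lambda>x\<in>S. (?g (e \<otimes>\<^bsub>R\<^esub> x), ?h (d \<otimes>\<^bsub>R\<^esub> x))) x = \<phi> x"
            using x eE[OF x] dC[OF x] by (simp add: prod_eq_iff)
        qed (use ext in simp_all)
        then show ?thesis
          using g hb pr by (simp add: \<Theta>_def \<Theta>'_def I_def ext_bij_def)
      qed
      have key': "\<Theta>' y \<in> I \<and> \<Theta> (\<Theta>' y) = y" if "y \<in> {y \<in> Y. \<Psi> y = x}" for y
        using that key[of "fst y" "snd y"] by simp
      then show "\<forall>y\<in>{y \<in> Y. \<Psi> y = x}. \<Theta> (\<Theta>' y) = y" by blast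
      show "\<Theta>' ` {y \<in> Y. \<Psi> y = x} \<subseteq> I" using key' by (intro image_subsetI) blast
    qed
    then have "card {y \<in> Y. \<Psi> y = x} = card I" by (simp add: bij_betw_same_card)
    also have "\<dots> = k * fact m"
      unfolding I_def card_cartesian_product E_def
      using card_field_isos[OF e(3) _ K(1,2) cE K(3) p] card_ext_bij(1)[OF finC(1), of B] finC cC
      by (simp add: B_def E_def)
    finally show ?thesis .
  qed

  \<comment> \<open>Every fibre has k m! > 0 elements, so \<Psi> maps the finite set Y onto
    Q.\<close>
  have finQ: "finite Q"
  proof (rule ccontr)
    assume "infinite Q"
    moreover have "Q \<subseteq> \<Psi> ` Y"
    proof
      fix x assume "x \<in> Q"
      then have "card {y \<in> Y. \<Psi> y = x} \<noteq> 0" using fiber p by simp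
      then have "{y \<in> Y. \<Psi> y = x} \<noteq> {}" by (metis card.empty)
      then show "x \<in> \<Psi> ` Y" by blast
    qed
    ultimately show False using finY finite_subset by blast
  qed
  have "card Y = (\<Sum>x\<in>Q. card {y \<in> Y. \<Psi> y = x})"
    using sum.group[OF finY finQ \<Psi>Q, of "\<lambda>_. 1 :: nat"] by simp
  also have "\<dots> = card Q * (k * fact m)" using fiber by simp
  finally have "(k * card Q) * fact m = fact (card S) * (fact m :: nat)" using cY by (simp add: ac_simps)
  then show ?thesis unfolding Q_def by simp
qed

section \<open>Induction on the order by logarithmic weights\<close>

lemma finite_riemann_species:
  assumes "finite S"
  shows "finite (riemann_species S)"
proof (rule finite_subset)
  show "riemann_species S \<subseteq> (S \<rightarrow>\<^sub>E S \<rightarrow>\<^sub>E S) \<times> (S \<rightarrow>\<^sub>E S \<rightarrow>\<^sub>E S)"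
    by (auto simp: riemann_species_def)
  show "finite ((S \<rightarrow>\<^sub>E S \<rightarrow>\<^sub>E S) \<times> (S \<rightarrow>\<^sub>E S \<rightarrow>\<^sub>E S))"
    using assms by (intro finite_cartesian_product finite_PiE) auto
qed

text \<open>The one-element ring is the empty product of fields, and a singleton admits only one
  binary operation. This case stands apart because ln 1 = 0 leaves the logarithmic identity
  empty.\<close>

lemma card_riemann_species_singleton: "card (riemann_species {c}) = 1"
proof -
  have eq: "f = g" if "f \<in> {c} \<rightarrow>\<^sub>E {c} \<rightarrow>\<^sub>E {c}" "g \<in> {c} \<rightarrow>\<^sub>E {c} \<rightarrow>\<^sub>E {c}" for f g :: "'a \<Rightarrow> 'a \<Rightarrow> 'a"
  proof (rule PiE_ext[OF that])
    fix x assume x: "x \<in> {c}"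
    show "f x = g x"
    proof (rule PiE_ext[OF PiE_mem[OF that(1) x] PiE_mem[OF that(2) x]])
      fix y assume y: "y \<in> {c}"
      show "f x y = g x y"
        using PiE_mem[OF PiE_mem[OF that(1) x] y] PiE_mem[OF PiE_mem[OF that(2) x] y] by simp
    qed
  qed
  have "bij_betw (\<lambda>_. []) {c} (carrier (nil_ring :: 'a list ring))" by (simp add: bij_betw_def)
  from pullback_ops_in_species[OF reduced_finite_nil_ring this]
  obtain s where s: "s \<in> riemann_species {c}" by blast
  have "riemann_species {c} = {s}"
    using s eq by (auto simp: riemann_species_def)
  then show ?thesis by simp
qed

text \<open>Summing \<open>ln \<bar>eR\<bar>\<close> over all \<open>(R, e)\<close> in two ways reduces the count to
  \<open>\<Sum>d dvd n. mangoldt d = ln n\<close>.\<close>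
lemma card_riemann_species_step:
  fixes S :: "'a set"
  assumes S: "finite S" "card S = n" "n \<ge> 2"
    and IH: "\<And>m. m \<ge> 1 \<Longrightarrow> m < n \<Longrightarrow> card (riemann_species {0..<m}) = fact m"
  shows "card (riemann_species S) = fact n"
proof -
  define P where "P = (SIGMA s:riemann_species S. field_idempotents (species_ring S s))"
  define w where "w = (\<lambda>(s, e). card (carrier (corner (species_ring S s) e)))"
  have fi: "finite (field_idempotents (species_ring S s))" if "s \<in> riemann_species S" for s
    using carrier_species_ring[OF that] S(1) by (simp add: field_idempotents_def)
  have finP: "finite P" unfolding P_def using finite_riemann_species[OF S(1)] fi by (intro finite_SigmaI)
  have split: "card (carrier (corner (species_ring S s) e)) dvd n"
      "field (corner (species_ring S s) e)" "finite (carrier (corner (species_ring S s) e))"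
    if "s \<in> riemann_species S" "e \<in> field_idempotents (species_ring S s)" for s e
  proof -
    have e: "e \<in> carrier (species_ring S s)" "e \<otimes>\<^bsub>species_ring S s\<^esub> e = e"
      using that by (auto simp: field_idempotents_def)
    show "card (carrier (corner (species_ring S s) e)) dvd n"
      using reduced_finite_card_split[OF reduced_finite_species_ring[OF that(1)] e]
        carrier_species_ring[OF that(1)] S(2) by simp
    show "field (corner (species_ring S s) e)" using that by (simp add: field_idempotents_def)
    show "finite (carrier (corner (species_ring S s) e))"
      using carrier_species_ring[OF that(1)] S(1) by simp
  qed
  have wn: "w ` P \<subseteq> {d. d dvd n}" using split by (auto simp: w_def P_def)
  have by_ring: "(\<Sum>x\<in>P. ln (real (w x))) = (\<Sum>s\<in>riemann_species S. ln (real n))"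
  proof -
    have "(\<Sum>x\<in>P. ln (real (w x)))
        = (\<Sum>s\<in>riemann_species S. \<Sum>e\<in>field_idempotents (species_ring S s). ln (real (w (s, e))))"
      unfolding P_def using finite_riemann_species[OF S(1)] fi by (simp add: sum.Sigma)
    also have "\<dots> = (\<Sum>s\<in>riemann_species S. ln (real n))"
    proof (rule sum.cong[OF refl])
      fix s assume s: "s \<in> riemann_species S"
      have pos: "0 < w (s, e)" if "e \<in> field_idempotents (species_ring S s)" for e
        using field_card_ge_2[OF split(2,3)[OF s that]] by (simp add: w_def)
      have "(\<Sum>e\<in>field_idempotents (species_ring S s). ln (real (w (s, e))))
          = ln (\<Prod>e\<in>field_idempotents (species_ring S s). real (w (s, e)))"
        using pos by (subst ln_prod) (auto simp: fi[OF s])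
      also have "(\<Prod>e\<in>field_idempotents (species_ring S s). real (w (s, e))) = real n"
        using prod_card_field_idempotents[OF reduced_finite_species_ring[OF s]]
          carrier_species_ring[OF s] S(2)
        by (simp add: w_def flip: of_nat_prod)
      finally show "(\<Sum>e\<in>field_idempotents (species_ring S s). ln (real (w (s, e)))) = ln (real n)" .
    qed
    finally show ?thesis .
  qed
  have by_order: "(\<Sum>x\<in>P. ln (real (w x))) = fact n * ln (real n)"
  proof -
    have "(\<Sum>x\<in>P. ln (real (w x))) = (\<Sum>d | d dvd n. \<Sum>x\<in>{x. x \<in> P \<and> w x = d}. ln (real (w x)))"
      using S(3) by (intro sum.group[symmetric] finP wn) simp
    also have "\<dots> = (\<Sum>d | d dvd n. fact n * mangoldt d)"
    proof (rule sum.cong[OF refl], clarify)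
      fix d assume d: "d dvd n"
      have sum_eq: "(\<Sum>x\<in>{x. x \<in> P \<and> w x = d}. ln (real (w x)))
          = real (card {x \<in> P. w x = d}) * ln (real d)" by simp
      show "(\<Sum>x\<in>{x. x \<in> P \<and> w x = d}. ln (real (w x))) = fact n * mangoldt d"
      proof (cases "primepow d")
        case True
        then obtain p k where pk: "prime p" "k > 0" "d = p ^ k" by (auto simp: primepow_def)
        obtain K :: "int poly set ring" where K: "field K" "finite (carrier K)" "card (carrier K) = p ^ k"
          using exists_finite_field[OF pk(1,2)] by blast
        obtain m where m: "n = d * m" using d by (auto elim: dvdE)
        \<comment> \<open>A field factor is nontrivial, so the complementary order m is strictly
          below n and the induction hypothesis applies to it.\<close>
        have "d > 1" using True by (simp add: primepow_gt_Suc_0)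
        have "m \<ge> 1" using m S(3) by (cases m) auto
        moreover have "m < n" using m \<open>d > 1\<close> \<open>m \<ge> 1\<close> by simp
        ultimately have B: "card (riemann_species {0..<m}) = fact m" by (rule IH)
        have cS: "card S = p ^ k * m" using S(2) m pk(3) by simp
        have "{x \<in> P. w x = d} = {(s, e). s \<in> riemann_species S \<and>
            e \<in> field_idempotents (species_ring S s) \<and>
            card (carrier (corner (species_ring S s) e)) = p ^ k}"
          by (auto simp: P_def w_def pk(3))
        then have "k * card {x \<in> P. w x = d} = fact n"
          using card_species_with_field_factor[OF S(1) cS K pk(1,2) B] S(2) by simp
        then have c: "real k * real (card {x \<in> P. w x = d}) = fact n"
          by (simp flip: of_nat_mult)
        have l: "ln (real d) = real k * ln (real p)"
          using pk by (simp add: ln_realpow prime_gt_0_nat)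
        have "mangoldt d = ln (real p)" using pk by simp
        then show ?thesis unfolding sum_eq l c[symmetric] by (simp add: ac_simps)
      next
        case False
        \<comment> \<open>Finite fields have prime power order, so for any other d there are no
          pairs and \<open>mangoldt d\<close> vanishes as well.\<close>
        have empty: "{x \<in> P. w x = d} = {}"
        proof -
          have "primepow (w x)" if "x \<in> P" for x
          proof -
            obtain s e where se: "x = (s, e)" by (cases x)
            then have x: "s \<in> riemann_species S" "e \<in> field_idempotents (species_ring S s)"
              using that by (simp_all add: P_def)
            obtain p k where "prime p" "k > 0" "card (carrier (corner (species_ring S s) e)) = p ^ k"
              using finite_field_card[OF split(2,3)[OF x]] by metis
            then show ?thesis by (simp add: se w_def)
          qed
          then show ?thesis using False by blast
        qed
        show ?thesis using False unfolding sum_eq empty by (simp add: mangoldt_def)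
      qed
    qed
    also have "\<dots> = fact n * (\<Sum>d | d dvd n. mangoldt d)" by (simp add: sum_distrib_left)
    also have "(\<Sum>d | d dvd n. mangoldt d) = ln (real n)" using mangoldt_sum[of n, where 'a = real] S(3) by simp
    finally show ?thesis .
  qed
  have "real (card (riemann_species S)) * ln (real n) = (\<Sum>s\<in>riemann_species S. ln (real n))"
    by simp
  also have "\<dots> = fact n * ln (real n)"
    using by_ring by_order by (simp only:)
  finally have "real (card (riemann_species S)) * ln (real n) = fact n * ln (real n)" .
  \<comment> \<open>Cancelling the logarithm requires n \<ge> 2.\<close>
  moreover have "ln (real n) > 0" using S(3) by simp
  ultimately have "real (card (riemann_species S)) = real (fact n)" by simp
  then show ?thesis by (simp only: of_nat_eq_iff)
qed

text \<open>The induction runs over initial segments of the naturals, so its hypothesis stays in one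
  type; the step lemma then reaches a set S of any type.\<close>

lemma card_riemann_species_atLeastLessThan:
  assumes "m \<ge> 1"
  shows "card (riemann_species {0..<m}) = fact m"
  using assms
proof (induction m rule: less_induct)
  case (less m)
  show ?case
  proof (cases "m = 1")
    case True
    then have "{0..<m} = {0}" by auto
    then show ?thesis using True card_riemann_species_singleton[of "0::nat"] by (simp only: fact_1)
  next
    case False
    show ?thesis
    proof (rule card_riemann_species_step)
      show "m \<ge> 2" using False less.prems by simp
      show "card (riemann_species {0..<l}) = fact l" if "l \<ge> 1" "l < m" for l
        using less.IH[OF that(2,1)] .
    qed simp_all
  qed
qed

theorem theorem3p10:
  fixes S :: "'a set" and n :: nat
  assumes "finite S" and "card S = n" and "n \<ge> 1"
  shows "card (riemann_species S) = fact n"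
proof (cases "n = 1")
  case True
  then obtain c where "S = {c}" using assms(2) card_1_singletonE by blast
  then show ?thesis using True card_riemann_species_singleton[of c] by (simp only: fact_1)
next
  case False
  then have "n \<ge> 2" using assms(3) by simp
  then show ?thesis
    using card_riemann_species_step[OF assms(1,2)] card_riemann_species_atLeastLessThan by blast
qed

end
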